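(* Let $d=2$ and let $\kappa \geq 4$ be an even integer. Let $J_2 = (\cos^2(\pi/\kappa), \cos(\pi/\kappa))$. There is a strictly decreasing sequence of energies $\{\mathcal{E}_n\}_{n=0}^{\infty}$, depending on $\kappa$, with $\mathcal{E}_0 = \sup J_2 = \cos(\pi/\kappa)$, such that $\mathcal{E}_n \in \boldsymbol{\Theta}_{\kappa}(D)$ for all $n \geq 0$, $\mathcal{E}_n \in J_2$ for all $n\ge 1$, and $\mathcal{E}_n \searrow \inf J_2 = \cos^2(\pi/\kappa)$ as $n \to \infty$. Also, $\mathcal{E}_{2n-1} \in \boldsymbol{\Theta}_{n,\kappa}(D)$ and $\mathcal{E}_{2n} \in \boldsymbol{\Theta}_{n,\kappa}(D)$ for all $n \geq 1$.
   Context: Operators. For $d \geq 1$ let $\mathscr{H}=\ell^2(\mathbb{Z}^d)$, let $S_i$ be the shift $(S_i^{\pm 1} u)(n) = u(n_1,\ldots,n_i \mp 1,\ldots,n_d)$, $\Delta_i = \frac12 (S_i + S_i^* )$ and $D=D[d] = \prod_{i=1}^d \Delta_i$ (Molchanov--Vainberg Laplacian); $\sigma(D)=[-1,1]$. Let $(N_i u)(n) = n_i u(n)$. For $j,\kappa \in \mathbb{N}^*=\{1,2,\ldots\}$ let $A_i(j,\kappa)$ be the closure of $\frac{1}{4\mathrm{i}}\left[(S_i^{j\kappa}-S_i^{-j\kappa})N_i + N_i (S_i^{j\kappa}-S_i^{-j\kappa})\right]$ defined on compactly supported sequences, and $A_{j\kappa} = \sum_{i=1}^d A_i(j,\kappa)$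 (self-adjoint). Thresholds. $\boldsymbol{\mu}_\kappa(D)$ is the set of $E \in \sigma(D)$ for which there exist a self-adjoint linear combination (finite or infinite) $\mathbb{A} = \sum_{j \geq 1} \rho_{j\kappa} A_{j\kappa}$, $\rho_{j\kappa}\in\mathbb{R}$, an interval $I \ni E$ and $\gamma>0$ with $1_I(D)[D,\mathrm{i}\mathbb{A}]_\circ 1_I(D) \geq \gamma 1_I(D)$, where $[D,\mathrm{i}\mathbb{A}]_\circ$ is the bounded extension of the commutator from compactly supported sequences. $\boldsymbol{\Theta}_\kappa(D) = \sigma(D)\setminus \boldsymbol{\mu}_\kappa(D)$. Let $U_n$ be the Chebyshev polynomial of the second kind, $U_{n-1}(\cos\theta)=\sin(n\theta)/\sin\theta$. For $\vec{x}=(x_1,\ldots,x_d)\in[-1,1]^d$ let $g_{j\kappa}(\vec{x}) = \sum_{i=1}^d \big(\prod_{l \neq i} x_l\big)(1-x_i^2)U_{j\kappa-1}(x_i)$, and $S_E = \{\vec{x}\in[-1,1]^d : \prod_{l=1}^d x_l = E\}$. The function $G_\kappa = \sum_j \rho_{j\kappa} g_{j\kappa}$ represents $[D,\mathrm{i}\mathbb{A}]_\circ$ by functional calculus (with $\Delta_i \leftrightarrow x_i$), and by continuity of $G_\kappa$, $E\in\boldsymbol{\mu}_\kappa(D)$ iff $G_\kappa>0$ on $S_E$ for some such $\mathbb{A}$. $\boldsymbol{\Theta}_{0,\kappa}(D)$ is the set of $E\in[-1,1]$ such that there is $\vec{x}\in S_E$ with $g_{j\kappa}(\vec{x})=0$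 for all $j\in\mathbb{N}^*$. For $m\in\mathbb{N}^*$, $\boldsymbol{\Theta}_{m,\kappa}(D)$ is the set of $E\in[-1,1]$ such that there are $\vec{x}_0,\ldots,\vec{x}_m \in S_E$ and real numbers $\omega_0,\ldots,\omega_{m-1}\leq 0$ with $g_{j\kappa}(\vec{x}_m) = \sum_{q=0}^{m-1}\omega_q\, g_{j\kappa}(\vec{x}_q)$ for all $j\in\mathbb{N}^*$. *)

theory Defs
  imports "HOL-Analysis.Analysis"
begin

section \<open>The Hilbert space of square-summable sequences\<close>

text \<open>
  Vectors are plain functions; the Hilbert space is the carrier set \<open>ell2\<close>. Operators are
  functions on all sequences, of which only the values on \<open>ell2\<close> matter. Unbounded
  operators are graphs, i.e. sets of pairs of vectors.
\<close>

type_synonym 'a oper = "('a \<Rightarrow> complex) \<Rightarrow> ('a \<Rightarrow> complex)"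
type_synonym 'a graph = "(('a \<Rightarrow> complex) \<times> ('a \<Rightarrow> complex)) set"

definition ell2 :: "('a \<Rightarrow> complex) set" where
  "ell2 = {u. (\<lambda>n. (cmod (u n))\<^sup>2) summable_on UNIV}"

definition l2_norm :: "('a \<Rightarrow> complex) \<Rightarrow> real" where
  "l2_norm u = sqrt (\<Sum>\<^sub>\<infinity>n. (cmod (u n))\<^sup>2)"

definition l2_inner :: "('a \<Rightarrow> complex) \<Rightarrow> ('a \<Rightarrow> complex) \<Rightarrow> complex" where
  "l2_inner u v = (\<Sum>\<^sub>\<infinity>n. cnj (u n) * v n)"

definition l2_tendsto :: "(nat \<Rightarrow> 'a \<Rightarrow> complex) \<Rightarrow> ('a \<Rightarrow> complex) \<Rightarrow> bool" where
  "l2_tendsto U u \<longleftrightarrow> (\<forall>k. U k \<in> ell2) \<and> u \<in> ell2 \<and> (\<lambda>k. l2_norm (\<lambda>n. U k n - u n)) \<longlonglongrightarrow> 0"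

definition compactly_supported :: "('a \<Rightarrow> complex) set" where
  "compactly_supported = {u. finite {n. u n \<noteq> 0}}"

definition bounded_oper :: "'a oper \<Rightarrow> bool" where
  "bounded_oper T \<longleftrightarrow>
     (\<forall>u\<in>ell2. T u \<in> ell2) \<and>
     (\<forall>u\<in>ell2. \<forall>v\<in>ell2. \<forall>a b. T (\<lambda>n. a * u n + b * v n) = (\<lambda>n. a * T u n + b * T v n)) \<and>
     (\<exists>C. \<forall>u\<in>ell2. l2_norm (T u) \<le> C * l2_norm u)"

definition oper_le :: "'a oper \<Rightarrow> 'a oper \<Rightarrow> bool" where
  "oper_le S T \<longleftrightarrow> (\<forall>u\<in>ell2. l2_inner u (\<lambda>n. T u n - S u n) \<in> \<real>\<^sub>\<ge>\<^sub>0)"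

definition spectrum :: "'a oper \<Rightarrow> complex set" where
  "spectrum T = {z. \<not> (\<exists>R. bounded_oper R \<and>
      (\<forall>u\<in>ell2. R (\<lambda>n. T u n - z * u n) = u \<and> (\<lambda>n. T (R u) n - z * R u n) = u))}"

definition graph_closure :: "'a graph \<Rightarrow> 'a graph" where
  "graph_closure G = {(u, w). \<exists>U W. (\<forall>k. (U k, W k) \<in> G) \<and> l2_tendsto U u \<and> l2_tendsto W w}"

definition graph_adjoint :: "'a graph \<Rightarrow> 'a graph" where
  "graph_adjoint G = {(v, w). v \<in> ell2 \<and> w \<in> ell2 \<and>
     (\<forall>(x, y)\<in>G. l2_inner w x = l2_inner v y)}"

definition self_adjoint :: "'a graph \<Rightarrow> bool" where
  "self_adjoint G \<longleftrightarrow> graph_adjoint G = G"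

text \<open>
  Projection-valued measures on the Borel sets of the real line, and the spectral measure of a
  bounded self-adjoint operator, characterised by \<open>T = \<integral> t dP(t)\<close> in the sense of quadratic
  forms. Square integrability for every vector says that \<open>\<integral> t dP(t)\<close> is everywhere defined.
  By the spectral theorem a bounded self-adjoint operator has exactly one spectral measure (up
  to the irrelevant values off the Borel sets and off \<open>ell2\<close>), and \<open>P B\<close> is the operator
  \<open>1\<^sub>B(T)\<close> of the functional calculus.
\<close>

definition projection_valued_measure :: "(real set \<Rightarrow> 'a oper) \<Rightarrow> bool" where
  "projection_valued_measure P \<longleftrightarrow>
     (\<forall>B\<in>sets borel. bounded_oper (P B) \<and>
        (\<forall>u\<in>ell2. \<forall>v\<in>ell2. l2_inner (P B u) v = l2_inner u (P B v))) \<and>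
     (\<forall>u\<in>ell2. P UNIV u = u) \<and>
     (\<forall>B\<in>sets borel. \<forall>C\<in>sets borel. \<forall>u\<in>ell2. P (B \<inter> C) u = P B (P C u)) \<and>
     (\<forall>F :: nat \<Rightarrow> real set. range F \<subseteq> sets borel \<and> disjoint_family F \<longrightarrow>
        (\<forall>u\<in>ell2. l2_tendsto (\<lambda>k n. \<Sum>j<k. P (F j) u n) (P (\<Union>j. F j) u)))"

definition pvm_measure :: "(real set \<Rightarrow> 'a oper) \<Rightarrow> ('a \<Rightarrow> complex) \<Rightarrow> real measure" where
  "pvm_measure P u = measure_of UNIV (sets borel) (\<lambda>B. ennreal ((l2_norm (P B u))\<^sup>2))"

definition is_spectral_measure :: "'a oper \<Rightarrow> (real set \<Rightarrow> 'a oper) \<Rightarrow> bool" where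
  "is_spectral_measure T P \<longleftrightarrow>
     projection_valued_measure P \<and>
     (\<forall>u\<in>ell2. integrable (pvm_measure P u) (\<lambda>t. t\<^sup>2) \<and>
        l2_inner u (T u) = complex_of_real (\<integral>t. t \<partial>pvm_measure P u))"


section \<open>The Molchanov--Vainberg Laplacian and the conjugate operators\<close>

text \<open>\<open>shift i m\<close> is the power \<open>S\<^sub>i\<^sup>m\<close>, for an integer exponent.\<close>

definition shift :: "'d::finite \<Rightarrow> int \<Rightarrow> (int^'d) oper" where
  "shift i m u = (\<lambda>n. u (n - axis i m))"

definition Delta :: "'d::finite \<Rightarrow> (int^'d) oper" where
  "Delta i u = (\<lambda>n. (shift i 1 u n + shift i (- 1) u n) / 2)"

text \<open>The product of the commuting operators \<open>Delta i\<close> over all coordinates.\<close>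

definition MV :: "(int^'d::finite) oper" where
  "MV = Finite_Set.fold (\<lambda>i T. Delta i \<circ> T) id UNIV"

lemma comp_fun_commute_Delta: "comp_fun_commute (\<lambda>(i::'d::finite) T. Delta i \<circ> T)"
proof
  fix i j :: 'd
  have "Delta i (Delta j u) = Delta j (Delta i u)" for u
    by (auto simp: Delta_def shift_def fun_eq_iff field_simps intro!: arg_cong2[of _ _ _ _ "(+)"])
  then show "(\<lambda>T. Delta j \<circ> T) \<circ> (\<lambda>T. Delta i \<circ> T) = (\<lambda>T. Delta i \<circ> T) \<circ> (\<lambda>T. Delta j \<circ> T)"
    by (simp add: fun_eq_iff)
qed

lemma MV_2: "(MV :: (int^2) oper) = Delta 1 \<circ> Delta 2"
proof -
  interpret comp_fun_commute "\<lambda>(i::2) T. Delta i \<circ> T"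
    by (rule comp_fun_commute_Delta)
  have "(1::2) \<noteq> 2" by simp
  then have "(1::2) \<notin> {2}" by (simp only: singleton_iff not_False_eq_True)
  then show ?thesis
    unfolding MV_def UNIV_2 by (simp only: fold_insert fold_empty finite.intros empty_iff not_False_eq_True comp_id)
qed

definition position :: "'d::finite \<Rightarrow> (int^'d) oper" where
  "position i u = (\<lambda>n. of_int (n $ i) * u n)"

definition shift_diff :: "'d::finite \<Rightarrow> nat \<Rightarrow> (int^'d) oper" where
  "shift_diff i m u = (\<lambda>n. shift i (int m) u n - shift i (- int m) u n)"

text \<open>\<open>conj_comp i (j * \<kappa>)\<close> and \<open>conj_op (j * \<kappa>)\<close> are \<open>A\<^sub>i(j, \<kappa>)\<close> and \<open>A\<^bsub>j\<kappa>\<^esub>\<close>.\<close>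

definition conj_comp :: "'d::finite \<Rightarrow> nat \<Rightarrow> (int^'d) graph" where
  "conj_comp i m = graph_closure
     {(u, \<lambda>n. (shift_diff i m (position i u) n + position i (shift_diff i m u) n) / (4 * \<i>)) |u.
        u \<in> compactly_supported}"

definition conj_op :: "nat \<Rightarrow> (int^'d::finite) graph" where
  "conj_op m = {(u, w). \<exists>v. (\<forall>i. (u, v i) \<in> conj_comp i m) \<and> w = (\<lambda>n. \<Sum>i\<in>UNIV. v i n)}"

text \<open>
  A finite or infinite linear combination \<open>\<Sum>\<^sub>j \<rho>\<^sub>j A\<^bsub>j\<kappa>\<^esub>\<close>: the closure of the operator acting
  on those compactly supported sequences on which the series converges in \<open>ell2\<close>. A finite
  combination has \<open>\<rho>\<close> of finite support. The value \<open>\<rho> 0\<close> is not used.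
\<close>

definition lin_comb_core :: "nat \<Rightarrow> (nat \<Rightarrow> real) \<Rightarrow> (int^'d::finite) graph" where
  "lin_comb_core \<kappa> \<rho> = {(u, w). u \<in> compactly_supported \<and>
     (\<exists>v. (\<forall>j\<ge>1. (u, v j) \<in> conj_op (j * \<kappa>)) \<and>
          l2_tendsto (\<lambda>J n. \<Sum>j = 1..J. of_real (\<rho> j) * v j n) w)}"

definition lin_comb :: "nat \<Rightarrow> (nat \<Rightarrow> real) \<Rightarrow> (int^'d::finite) graph" where
  "lin_comb \<kappa> \<rho> = graph_closure (lin_comb_core \<kappa> \<rho>)"

definition selfadjoint_lin_comb :: "nat \<Rightarrow> (int^'d::finite) graph \<Rightarrow> bool" where
  "selfadjoint_lin_comb \<kappa> A \<longleftrightarrow>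
     (\<exists>\<rho>. compactly_supported \<subseteq> Domain (lin_comb_core \<kappa> \<rho> :: (int^'d) graph) \<and>
          A = lin_comb \<kappa> \<rho> \<and> self_adjoint A)"

text \<open>\<open>B\<close> is the bounded extension of the commutator \<open>[H, \<i>A] = \<i>(H A - A H)\<close>.\<close>

definition is_commutator :: "'a oper \<Rightarrow> 'a graph \<Rightarrow> 'a oper \<Rightarrow> bool" where
  "is_commutator H A B \<longleftrightarrow> bounded_oper B \<and>
     (\<forall>u\<in>compactly_supported. \<exists>v w. (u, v) \<in> A \<and> (H u, w) \<in> A \<and>
        B u = (\<lambda>n. \<i> * (H v n - w n)))"


section \<open>Thresholds\<close>

text \<open>The interval \<open>I\<close> in the Mourre estimate is an open neighbourhood of the energy.\<close>

definition mourre_set :: "nat \<Rightarrow> (int^'d::finite) oper \<Rightarrow> real set" where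
  "mourre_set \<kappa> H = {E. complex_of_real E \<in> spectrum H \<and>
     (\<exists>A B P a b \<gamma>. selfadjoint_lin_comb \<kappa> A \<and> is_commutator H A B \<and> is_spectral_measure H P \<and>
        a < E \<and> E < b \<and> \<gamma> > 0 \<and>
        oper_le (\<lambda>u n. of_real \<gamma> * P {a<..<b} u n) (P {a<..<b} \<circ> B \<circ> P {a<..<b}))}"

definition Theta :: "nat \<Rightarrow> (int^'d::finite) oper \<Rightarrow> real set" where
  "Theta \<kappa> H = {E. complex_of_real E \<in> spectrum H} - mourre_set \<kappa> H"

text \<open>Chebyshev polynomials of the second kind.\<close>

fun cheb_U :: "nat \<Rightarrow> real \<Rightarrow> real" where
  "cheb_U 0 x = 1"
| "cheb_U (Suc 0) x = 2 * x"
| "cheb_U (Suc (Suc n)) x = 2 * x * cheb_U (Suc n) x - cheb_U n x"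

lemma cheb_U_cos: "cheb_U n (cos t) * sin t = sin (real (Suc n) * t)"
proof (induction n "cos t" rule: cheb_U.induct)
  case 2
  show ?case by (simp add: sin_double)
next
  case (3 n)
  have "sin (real (Suc (Suc (Suc n))) * t) + sin (real (Suc n) * t)
      = 2 * cos t * sin (real (Suc (Suc n)) * t)"
    using sin_add[of "real (Suc (Suc n)) * t" t] sin_diff[of "real (Suc (Suc n)) * t" t]
    by (simp add: algebra_simps)
  with 3 show ?case by (simp add: algebra_simps)
qed simp

text \<open>\<open>g_fun (j * \<kappa>)\<close> is \<open>g\<^bsub>j\<kappa>\<^esub>\<close>; only positive indices are used.\<close>

definition g_fun :: "nat \<Rightarrow> real^'d::finite \<Rightarrow> real" where
  "g_fun m x = (\<Sum>i\<in>UNIV. (\<Prod>l\<in>UNIV - {i}. x $ l) * (1 - (x $ i)\<^sup>2) * cheb_U (m - 1) (x $ i))"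

definition energy_surface :: "real \<Rightarrow> (real^'d::finite) set" where
  "energy_surface E = {x. (\<forall>l. x $ l \<in> {-1..1}) \<and> (\<Prod>l\<in>UNIV. x $ l) = E}"

text \<open>
  The sets \<open>\<Theta>\<^bsub>m,\<kappa>\<^esub>(D)\<close> in dimension \<open>CARD('d)\<close>. For \<open>m = 0\<close> the sum is empty and this is the
  definition of \<open>\<Theta>\<^bsub>0,\<kappa>\<^esub>(D)\<close>.
\<close>

definition Theta_level :: "'d::finite itself \<Rightarrow> nat \<Rightarrow> nat \<Rightarrow> real set" where
  "Theta_level d m \<kappa> = {E \<in> {-1..1}. \<exists>(x :: nat \<Rightarrow> real^'d) (\<omega> :: nat \<Rightarrow> real).
     (\<forall>q\<le>m. x q \<in> energy_surface E) \<and> (\<forall>q<m. \<omega> q \<le> 0) \<and>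
     (\<forall>j\<ge>1. g_fun (j * \<kappa>) (x m) = (\<Sum>q<m. \<omega> q * g_fun (j * \<kappa>) (x q)))}"

definition J2 :: "nat \<Rightarrow> real set" where
  "J2 \<kappa> = {(cos (pi / real \<kappa>))\<^sup>2 <..< cos (pi / real \<kappa>)}"

end

theory Submission
  imports Defs
begin

text \<open>
  Write \<open>x = (cos a, cos b)\<close> for a point of the energy surface \<open>S\<^sub>E\<close>, so that
  \<open>cos a * cos b = E\<close>. The argument has an operator half and a trigonometric half.

  Operator half: every energy in some \<open>\<Theta>\<^bsub>m,\<kappa>\<^esub>\<close> is a threshold
  (\<open>Theta_level_subset_Theta\<close>). The plane wave \<open>exp(i(a n\<^sub>1 + b n\<^sub>2))\<close>, truncated to a box
  of side \<open>L\<close> and normalised, is an approximate eigenvector of the Laplacian at \<open>E\<close>. Hence \<open>E\<close>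
  is in the spectrum, and a spectral projection onto a neighbourhood of \<open>E\<close> moves the truncated
  wave by an amount that tends to \<open>0\<close> (\<open>spectral_localization\<close>). The commutator \<open>B\<close> with
  \<open>\<Sum>\<^sub>j \<rho>\<^sub>j A\<^bsub>j\<kappa>\<^esub>\<close> is a convergent series of finite combinations of translations, and its
  expectation in the wave tends to \<open>G(x) = \<Sum>\<^sub>j \<rho>\<^sub>j g\<^bsub>j\<kappa>\<^esub>(x)\<close>
  (\<open>commutator_form_tendsto\<close>). So a Mourre estimate with constant \<open>\<gamma>\<close> at \<open>E\<close> forces
  \<open>G \<ge> \<gamma> > 0\<close> on all of \<open>S\<^sub>E\<close> (\<open>mourre_lower_bound\<close>), while a relation
  \<open>g\<^bsub>j\<kappa>\<^esub>(x\<^sub>m) = \<Sum>\<^sub>q \<omega>\<^sub>q g\<^bsub>j\<kappa>\<^esub>(x\<^sub>q)\<close> with \<open>\<omega>\<^sub>q \<le> 0\<close> for all \<open>j\<close> gives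
  \<open>G(x\<^sub>m) \<le> 0\<close>.

  Trigonometric half: put \<open>\<alpha> = \<pi>/\<kappa>\<close>. In angles,
  \<open>g\<^bsub>j\<kappa>\<^esub> = cos b sin a sin(j\<kappa>a) + cos a sin b sin(j\<kappa>b)\<close>, and
  \<open>sin(j\<kappa>(2\<alpha> - s)) = - sin(j\<kappa>s)\<close> for every \<open>j\<close>. Given an angle \<open>r\<close>, the point of \<open>S\<^sub>E\<close> with second
  angle \<open>r\<close> and first angle \<open>2\<alpha> - r'\<close>, where \<open>r' = 2\<alpha> - arccos(E / cos r)\<close>, therefore has
  \<open>g\<^bsub>j\<kappa>\<^esub> = q sin(j\<kappa>r) - p sin(j\<kappa>r')\<close> with \<open>q \<ge> 0\<close> and \<open>p > 0\<close> independent of \<open>j\<close>. Iterating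
  \<open>r \<mapsto> r'\<close> from \<open>r\<^sub>0 = 0\<close>, where all the sines vanish, writes each nonnegative multiple of
  \<open>sin(j\<kappa>r\<^sub>n)\<close> as a combination with nonpositive weights of the values of \<open>g\<^bsub>j\<kappa>\<^esub>\<close> at the first
  \<open>n\<close> points (\<open>chain_dependence\<close>). The chain closes up to a dependence when one more point of \<open>S\<^sub>E\<close>
  contributes only a nonnegative multiple of \<open>sin(j\<kappa>r\<^sub>n)\<close>. This happens in two ways: either
  \<open>r\<^bsub>n+1\<^esub> = \<alpha>\<close>, where the sines vanish again, or \<open>r\<^sub>n = arccos(sqrt E)\<close>, where the diagonal point
  \<open>(sqrt E, sqrt E)\<close> has both angles equal to \<open>r\<^sub>n\<close>.

  Starting with \<open>E = cos \<alpha>\<close>, for which \<open>r\<^sub>1 = \<alpha>\<close>, the intermediate value theorem produces energies of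
  the two kinds alternately, each below the previous one and above \<open>cos\<^sup>2 \<alpha>\<close>
  (\<open>exists_odd_energy\<close>, \<open>exists_even_energy\<close>). They converge to \<open>cos\<^sup>2 \<alpha>\<close>: a
  fixed angle satisfies \<open>cos r * cos(2\<alpha> - r) = E\<close>, which is impossible for \<open>E > cos\<^sup>2 \<alpha>\<close>, so above
  that value every chain passes \<open>\<alpha>\<close> after finitely many steps (\<open>orbit_escapes\<close>).
\<close>

section \<open>Square-summable sequences\<close>

lemma ell2_square_summable: "u \<in> ell2 \<Longrightarrow> (\<lambda>n. (cmod (u n))\<^sup>2) summable_on UNIV"
  by (simp add: ell2_def)

lemma ell2_scale [intro]: "u \<in> ell2 \<Longrightarrow> (\<lambda>n. c * u n) \<in> ell2"
  by (simp add: ell2_def norm_mult power_mult_distrib summable_on_cmult_right)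

lemma ell2_add [intro]:
  assumes "u \<in> ell2" "v \<in> ell2" shows "(\<lambda>n. u n + v n) \<in> ell2"
proof -
  have "(\<lambda>n. 2 * (cmod (u n))\<^sup>2 + 2 * (cmod (v n))\<^sup>2) summable_on UNIV"
    using assms by (intro summable_on_add summable_on_cmult_right ell2_square_summable)
  moreover have "(cmod (u n + v n))\<^sup>2 \<le> 2 * (cmod (u n))\<^sup>2 + 2 * (cmod (v n))\<^sup>2" for n
  proof -
    have "(cmod (u n + v n))\<^sup>2 \<le> (cmod (u n) + cmod (v n))\<^sup>2"
      by (intro power_mono norm_triangle_ineq) auto
    also have "\<dots> \<le> 2 * (cmod (u n))\<^sup>2 + 2 * (cmod (v n))\<^sup>2"
      using sum_squares_ge_zero[of "cmod (u n) - cmod (v n)" 0] by (simp add: power2_eq_square algebra_simps)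
    finally show ?thesis .
  qed
  ultimately show ?thesis
    unfolding ell2_def by (auto intro: summable_on_comparison_test)
qed

lemma ell2_diff [intro]:
  assumes "u \<in> ell2" "v \<in> ell2" shows "(\<lambda>n. u n - v n) \<in> ell2"
  using ell2_add[OF assms(1) ell2_scale[OF assms(2), of "-1"]] by simp

lemma ell2_zero [simp, intro]: "(\<lambda>n. 0) \<in> ell2"
  by (simp add: ell2_def)

lemma ell2_sum [intro]:
  "(\<And>k. k \<in> K \<Longrightarrow> U k \<in> ell2) \<Longrightarrow> (\<lambda>n. \<Sum>k\<in>K. U k n) \<in> ell2"
  by (induction K rule: infinite_finite_induct) auto

lemma compactly_supported_ell2: "u \<in> compactly_supported \<Longrightarrow> u \<in> ell2"
  unfolding ell2_def compactly_supported_def mem_Collect_eq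
  by (subst summable_on_cong_neutral[of "{n. u n \<noteq> 0}" UNIV]) auto

lemma l2_norm_nonneg [simp]: "0 \<le> l2_norm u"
  by (simp add: l2_norm_def infsum_nonneg)

lemma l2_norm_square: "(l2_norm u)\<^sup>2 = (\<Sum>\<^sub>\<infinity>n. (cmod (u n))\<^sup>2)"
  by (simp add: l2_norm_def infsum_nonneg)

lemma l2_inner_abs_summable:
  assumes "u \<in> ell2" "v \<in> ell2"
  shows "(\<lambda>n. cmod (cnj (u n) * v n)) summable_on UNIV"
proof (rule summable_on_comparison_test)
  show "(\<lambda>n. (cmod (u n))\<^sup>2 + (cmod (v n))\<^sup>2) summable_on UNIV"
    using assms by (intro summable_on_add ell2_square_summable)
  show "cmod (cnj (u n) * v n) \<le> (cmod (u n))\<^sup>2 + (cmod (v n))\<^sup>2" for n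
    using sum_squares_bound[of "cmod (u n)" "cmod (v n)"]
      mult_nonneg_nonneg[of "cmod (u n)" "cmod (v n)"] unfolding norm_mult complex_mod_cnj mult.assoc
    by (smt (verit) norm_ge_zero)
qed auto

lemma l2_inner_summable:
  "u \<in> ell2 \<Longrightarrow> v \<in> ell2 \<Longrightarrow> (\<lambda>n. cnj (u n) * v n) summable_on UNIV"
  by (rule abs_summable_summable[OF l2_inner_abs_summable])

lemma l2_inner_add_right:
  "u \<in> ell2 \<Longrightarrow> v \<in> ell2 \<Longrightarrow> w \<in> ell2 \<Longrightarrow>
    l2_inner u (\<lambda>n. v n + w n) = l2_inner u v + l2_inner u w"
  unfolding l2_inner_def distrib_left by (intro infsum_add l2_inner_summable)

lemma l2_inner_scale_right: "l2_inner u (\<lambda>n. c * v n) = c * l2_inner u v"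
  unfolding l2_inner_def mult.left_commute[of _ c] by (rule infsum_cmult_right')

lemma l2_inner_diff_right:
  "u \<in> ell2 \<Longrightarrow> v \<in> ell2 \<Longrightarrow> w \<in> ell2 \<Longrightarrow>
    l2_inner u (\<lambda>n. v n - w n) = l2_inner u v - l2_inner u w"
  using l2_inner_add_right[of u v "\<lambda>n. (-1) * w n"] ell2_scale[of w "-1"]
    l2_inner_scale_right[of u "-1" w] by simp

lemma l2_inner_cnj: "cnj (l2_inner u v) = l2_inner v u"
  unfolding l2_inner_def infsum_cnj[symmetric] by (simp add: mult.commute)

lemma l2_inner_add_left:
  "u \<in> ell2 \<Longrightarrow> v \<in> ell2 \<Longrightarrow> w \<in> ell2 \<Longrightarrow>
    l2_inner (\<lambda>n. v n + w n) u = l2_inner v u + l2_inner w u"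
  using arg_cong[OF l2_inner_add_right[of u v w], of cnj] by (simp add: l2_inner_cnj)

lemma l2_inner_diff_left:
  "u \<in> ell2 \<Longrightarrow> v \<in> ell2 \<Longrightarrow> w \<in> ell2 \<Longrightarrow>
    l2_inner (\<lambda>n. v n - w n) u = l2_inner v u - l2_inner w u"
  using arg_cong[OF l2_inner_diff_right[of u v w], of cnj] by (simp add: l2_inner_cnj)

lemma l2_inner_scale_left: "l2_inner (\<lambda>n. c * v n) u = cnj c * l2_inner v u"
  using arg_cong[OF l2_inner_scale_right[of u c v], of cnj] by (simp add: l2_inner_cnj)

lemma l2_inner_sum_right:
  "u \<in> ell2 \<Longrightarrow> (\<And>k. k \<in> K \<Longrightarrow> U k \<in> ell2) \<Longrightarrow>
    l2_inner u (\<lambda>n. \<Sum>k\<in>K. U k n) = (\<Sum>k\<in>K. l2_inner u (U k))"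
proof (induction K rule: infinite_finite_induct)
  case (insert k K)
  then show ?case by (simp add: l2_inner_add_right ell2_sum)
qed (simp_all add: l2_inner_def)

lemma l2_inner_sum_left:
  "u \<in> ell2 \<Longrightarrow> (\<And>k. k \<in> K \<Longrightarrow> U k \<in> ell2) \<Longrightarrow>
    l2_inner (\<lambda>n. \<Sum>k\<in>K. U k n) u = (\<Sum>k\<in>K. l2_inner (U k) u)"
  using arg_cong[OF l2_inner_sum_right[of u K U], of cnj] by (simp add: l2_inner_cnj)

lemma l2_inner_self:
  assumes "u \<in> ell2" shows "l2_inner u u = complex_of_real ((l2_norm u)\<^sup>2)"
proof -
  have "l2_inner u u = (\<Sum>\<^sub>\<infinity>n. complex_of_real ((cmod (u n))\<^sup>2))"
    unfolding l2_inner_def by (simp only: complex_norm_square mult.commute)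
  also have "\<dots> = complex_of_real ((l2_norm u)\<^sup>2)"
    unfolding l2_norm_square
    by (intro infsumI has_sum_of_real has_sum_infsum ell2_square_summable assms)
  finally show ?thesis .
qed

lemma cmod_le_l2_norm:
  assumes "u \<in> ell2" shows "cmod (u n) \<le> l2_norm u"
proof -
  have "(\<Sum>k\<in>{n}. (cmod (u k))\<^sup>2) \<le> (\<Sum>\<^sub>\<infinity>k. (cmod (u k))\<^sup>2)"
    using assms by (intro finite_sum_le_infsum ell2_square_summable) auto
  then have "(cmod (u n))\<^sup>2 \<le> (l2_norm u)\<^sup>2" by (simp add: l2_norm_square)
  then show ?thesis by (rule power2_le_imp_le) simp
qed

lemma l2_cauchy_schwarz:
  assumes u: "u \<in> ell2" and v: "v \<in> ell2"
  shows "cmod (l2_inner u v) \<le> l2_norm u * l2_norm v"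
proof -
  have *: "L2_set (\<lambda>n. cmod (w n)) F \<le> l2_norm w" if "finite F" "w \<in> ell2" for F and w :: "'a \<Rightarrow> complex"
    unfolding L2_set_def l2_norm_def using that
    by (intro real_sqrt_le_mono finite_sum_le_infsum ell2_square_summable) auto
  have "cmod (l2_inner u v) \<le> (\<Sum>\<^sub>\<infinity>n. cmod (cnj (u n) * v n))"
    unfolding l2_inner_def by (rule norm_infsum_bound[OF l2_inner_abs_summable[OF u v]])
  also have "\<dots> \<le> l2_norm u * l2_norm v"
  proof (rule infsum_le_finite_sums[OF l2_inner_abs_summable[OF u v]])
    fix F :: "'a set" assume F: "finite F"
    have "(\<Sum>n\<in>F. cmod (cnj (u n) * v n)) \<le> L2_set (\<lambda>n. cmod (u n)) F * L2_set (\<lambda>n. cmod (v n)) F"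
      using L2_set_mult_ineq[of "\<lambda>n. cmod (u n)" "\<lambda>n. cmod (v n)" F] by (simp add: norm_mult)
    also have "\<dots> \<le> l2_norm u * l2_norm v"
      using F u v by (intro mult_mono * L2_set_nonneg) auto
    finally show "(\<Sum>n\<in>F. cmod (cnj (u n) * v n)) \<le> l2_norm u * l2_norm v" .
  qed
  finally show ?thesis .
qed

lemma l2_norm_triangle:
  assumes u: "u \<in> ell2" and v: "v \<in> ell2"
  shows "l2_norm (\<lambda>n. u n + v n) \<le> l2_norm u + l2_norm v"
proof (rule power2_le_imp_le)
  have "complex_of_real ((l2_norm (\<lambda>n. u n + v n))\<^sup>2)
      = (l2_norm u)\<^sup>2 + (l2_norm v)\<^sup>2 + (l2_inner u v + cnj (l2_inner u v))"
    using u v by (simp add: l2_inner_self[symmetric] l2_inner_add_left l2_inner_add_right ell2_add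
      l2_inner_cnj del: of_real_power)
  also have "\<dots> = complex_of_real ((l2_norm u)\<^sup>2 + (l2_norm v)\<^sup>2 + 2 * Re (l2_inner u v))"
    by (simp add: complex_add_cnj)
  finally have "(l2_norm (\<lambda>n. u n + v n))\<^sup>2 = (l2_norm u)\<^sup>2 + (l2_norm v)\<^sup>2 + 2 * Re (l2_inner u v)"
    using of_real_eq_iff by blast
  also have "\<dots> \<le> (l2_norm u + l2_norm v)\<^sup>2"
    using complex_Re_le_cmod[of "l2_inner u v"] l2_cauchy_schwarz[OF u v]
    by (simp add: power2_sum)
  finally show "(l2_norm (\<lambda>n. u n + v n))\<^sup>2 \<le> (l2_norm u + l2_norm v)\<^sup>2" .
qed simp

lemma l2_norm_scale: "l2_norm (\<lambda>n. c * u n) = cmod c * l2_norm u"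
  by (simp add: l2_norm_def norm_mult power_mult_distrib infsum_cmult_right' real_sqrt_mult)

lemma l2_tendsto_pointwise:
  assumes "l2_tendsto U u" shows "(\<lambda>k. U k n) \<longlonglongrightarrow> u n"
proof -
  have "cmod (U k n - u n) \<le> l2_norm (\<lambda>n. U k n - u n)" for k
    using assms cmod_le_l2_norm[OF ell2_diff, of "U k" u] by (auto simp: l2_tendsto_def)
  moreover have "(\<lambda>k. l2_norm (\<lambda>n. U k n - u n)) \<longlonglongrightarrow> 0"
    using assms by (simp add: l2_tendsto_def)
  ultimately have "(\<lambda>k. U k n - u n) \<longlonglongrightarrow> 0"
    by (intro Lim_null_comparison[of "\<lambda>k. U k n - u n"]) auto
  then show ?thesis by (simp add: LIM_zero_iff)
qed

lemma l2_tendsto_inner: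
  assumes "l2_tendsto U u" and w: "w \<in> ell2"
  shows "(\<lambda>k. l2_inner w (U k)) \<longlonglongrightarrow> l2_inner w u"
proof -
  have U: "U k \<in> ell2" and u: "u \<in> ell2" for k using assms by (auto simp: l2_tendsto_def)
  have "cmod (l2_inner w (U k) - l2_inner w u) \<le> l2_norm w * l2_norm (\<lambda>n. U k n - u n)" for k
    using l2_cauchy_schwarz[OF w ell2_diff[OF U u]] by (simp add: l2_inner_diff_right w U u)
  moreover have "(\<lambda>k. l2_norm w * l2_norm (\<lambda>n. U k n - u n)) \<longlonglongrightarrow> l2_norm w * 0"
    using assms(1) by (intro tendsto_mult) (auto simp: l2_tendsto_def)
  ultimately have "(\<lambda>k. l2_inner w (U k) - l2_inner w u) \<longlonglongrightarrow> 0"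
    by (intro Lim_null_comparison[of "\<lambda>k. l2_inner w (U k) - l2_inner w u"]) auto
  then show ?thesis by (simp add: LIM_zero_iff)
qed

lemma l2_inner_finite_support:
  assumes "finite F" "\<And>n. n \<notin> F \<Longrightarrow> u n = 0"
  shows "l2_inner u v = (\<Sum>n\<in>F. cnj (u n) * v n)"
proof -
  have "l2_inner u v = (\<Sum>\<^sub>\<infinity>n\<in>F. cnj (u n) * v n)"
    unfolding l2_inner_def using assms(2) by (intro infsum_cong_neutral) auto
  then show ?thesis using assms(1) by simp
qed

section \<open>Spectral localization of approximate eigenvectors\<close>

text \<open>
  Applied to countable additivity for the constant sequence of empty sets, this gives \<open>P {} = 0\<close>.
\<close>

lemma multiples_tendsto_self_imp_zero:
  fixes c :: complex
  assumes "(\<lambda>k. of_nat k * c) \<longlonglongrightarrow> c" shows "c = 0"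
proof -
  have "(\<lambda>k. of_nat (Suc k) * c - of_nat k * c) \<longlonglongrightarrow> c - c"
    using assms by (intro tendsto_diff LIMSEQ_Suc)
  then have "(\<lambda>k::nat. c) \<longlonglongrightarrow> 0" by (simp add: algebra_simps)
  then show ?thesis by (simp add: LIMSEQ_const_iff)
qed

context
  fixes P :: "real set \<Rightarrow> 'a oper"
  assumes pvm: "projection_valued_measure P"
begin

lemma pvm_ell2: "B \<in> sets borel \<Longrightarrow> u \<in> ell2 \<Longrightarrow> P B u \<in> ell2"
  using pvm by (auto simp: projection_valued_measure_def bounded_oper_def)

lemma pvm_linear:
  "B \<in> sets borel \<Longrightarrow> u \<in> ell2 \<Longrightarrow> v \<in> ell2 \<Longrightarrow>
    P B (\<lambda>n. a * u n + b * v n) = (\<lambda>n. a * P B u n + b * P B v n)"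
  using pvm by (auto simp: projection_valued_measure_def bounded_oper_def)

lemma pvm_symmetric:
  "B \<in> sets borel \<Longrightarrow> u \<in> ell2 \<Longrightarrow> v \<in> ell2 \<Longrightarrow> l2_inner (P B u) v = l2_inner u (P B v)"
  using pvm by (auto simp: projection_valued_measure_def)

lemma pvm_Int:
  "B \<in> sets borel \<Longrightarrow> C \<in> sets borel \<Longrightarrow> u \<in> ell2 \<Longrightarrow> P B (P C u) = P (B \<inter> C) u"
  using pvm by (auto simp: projection_valued_measure_def)

lemma pvm_UNIV: "u \<in> ell2 \<Longrightarrow> P UNIV u = u"
  using pvm by (auto simp: projection_valued_measure_def)

lemma pvm_UN:
  fixes F :: "nat \<Rightarrow> real set"
  shows "range F \<subseteq> sets borel \<Longrightarrow> disjoint_family F \<Longrightarrow> u \<in> ell2 \<Longrightarrow>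
    l2_tendsto (\<lambda>k n. \<Sum>j<k. P (F j) u n) (P (\<Union>j. F j) u)"
  using pvm by (auto simp: projection_valued_measure_def)

lemma pvm_empty: "u \<in> ell2 \<Longrightarrow> P {} u = (\<lambda>n. 0)"
proof
  fix n assume "u \<in> ell2"
  then have "l2_tendsto (\<lambda>k n. \<Sum>j<k. P {} u n) (P {} u)"
    using pvm_UN[of "\<lambda>_. {}" u] by (simp add: disjoint_family_on_def)
  then have "(\<lambda>k. of_nat k * P {} u n) \<longlonglongrightarrow> P {} u n"
    by (auto dest: l2_tendsto_pointwise)
  then show "P {} u n = 0" by (rule multiples_tendsto_self_imp_zero)
qed

lemma pvm_union:
  assumes B: "B \<in> sets borel" and C: "C \<in> sets borel" and disj: "B \<inter> C = {}" and u: "u \<in> ell2"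
  shows "P (B \<union> C) u n = P B u n + P C u n"
proof (rule LIMSEQ_unique)
  have "l2_tendsto (\<lambda>k n. \<Sum>j<k. P (binaryset B C j) u n) (P (\<Union>j. binaryset B C j) u)"
    using B C disj u
    by (intro pvm_UN) (auto simp: binaryset_def disjoint_family_on_def)
  then show "(\<lambda>k. \<Sum>j<k. P (binaryset B C j) u n) \<longlonglongrightarrow> P (B \<union> C) u n"
    by (auto dest: l2_tendsto_pointwise simp: UN_binaryset_eq)
  have "(\<Sum>j<Suc (Suc k). P (binaryset B C j) u n) = P B u n + P C u n" for k
    by (induction k) (auto simp: binaryset_def pvm_empty[OF u])
  then have "\<forall>\<^sub>F k in sequentially. (\<Sum>j<k. P (binaryset B C j) u n) = P B u n + P C u n"
    unfolding eventually_sequentially by (intro exI[of _ 2]) (metis add_2_eq_Suc le_Suc_ex)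
  then show "(\<lambda>k. \<Sum>j<k. P (binaryset B C j) u n) \<longlonglongrightarrow> P B u n + P C u n"
    by (rule tendsto_eventually)
qed

text \<open>
  A symmetric idempotent satisfies \<open>\<langle>u, P u\<rangle> = \<langle>P u, P u\<rangle>\<close>. The left side is additive in the set by
  definition of a projection-valued measure, which makes \<open>B \<mapsto> \<parallel>P B u\<parallel>\<^sup>2\<close> countably additive.
\<close>

lemma pvm_norm_square:
  assumes B: "B \<in> sets borel" and u: "u \<in> ell2"
  shows "l2_inner u (P B u) = complex_of_real ((l2_norm (P B u))\<^sup>2)"
  using pvm_symmetric[OF B u pvm_ell2[OF B u]] pvm_Int[OF B B u]
  by (simp add: l2_inner_self[OF pvm_ell2[OF B u]])

lemma emeasure_pvm_measure:
  assumes u: "u \<in> ell2" and B: "B \<in> sets borel"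
  shows "emeasure (pvm_measure P u) B = ennreal ((l2_norm (P B u))\<^sup>2)"
  unfolding pvm_measure_def
proof (rule emeasure_measure_of_sigma)
  let ?\<mu> = "\<lambda>B. ennreal ((l2_norm (P B u))\<^sup>2)"
  show "sigma_algebra UNIV (sets borel :: real set set)"
    using sets.sigma_algebra_axioms[of "borel :: real measure"] by simp
  show "positive (sets borel) ?\<mu>"
    by (simp add: positive_def pvm_empty[OF u] l2_norm_def)
  show "countably_additive (sets borel) ?\<mu>"
  proof (rule countably_additiveI)
    fix F :: "nat \<Rightarrow> real set"
    assume F: "range F \<subseteq> sets borel" "disjoint_family F" "(\<Union>i. F i) \<in> sets borel"
    then have Fi: "F i \<in> sets borel" for i by auto
    have "(\<lambda>k. l2_inner u (\<lambda>n. \<Sum>j<k. P (F j) u n)) \<longlonglongrightarrow> l2_inner u (P (\<Union>j. F j) u)"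
      using F u by (intro l2_tendsto_inner pvm_UN)
    moreover have "l2_inner u (\<lambda>n. \<Sum>j<k. P (F j) u n)
        = complex_of_real (\<Sum>j<k. (l2_norm (P (F j) u))\<^sup>2)" for k
      by (simp add: l2_inner_sum_right u pvm_ell2 Fi pvm_norm_square)
    ultimately have "(\<lambda>k. complex_of_real (\<Sum>j<k. (l2_norm (P (F j) u))\<^sup>2)) \<longlonglongrightarrow>
        complex_of_real ((l2_norm (P (\<Union>j. F j) u))\<^sup>2)"
      by (simp only: pvm_norm_square[OF F(3) u])
    then have "(\<lambda>j. (l2_norm (P (F j) u))\<^sup>2) sums (l2_norm (P (\<Union>j. F j) u))\<^sup>2"
      unfolding sums_def tendsto_of_real_iff .
    then show "(\<Sum>i. ?\<mu> (F i)) = ?\<mu> (\<Union>i. F i)"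
      by (intro suminf_ennreal_eq) auto
  qed
  show "B \<in> sets borel" by fact
qed

lemma sets_pvm_measure: "sets (pvm_measure P u) = sets borel"
  using sets.sigma_sets_eq[of "borel :: real measure"] by (simp add: pvm_measure_def)

lemma space_pvm_measure: "space (pvm_measure P u) = UNIV"
  by (simp add: pvm_measure_def space_measure_of_conv)

lemma finite_measure_pvm: "u \<in> ell2 \<Longrightarrow> finite_measure (pvm_measure P u)"
  by (rule finite_measureI) (simp add: emeasure_pvm_measure space_pvm_measure)

text \<open>
  By multiplicativity \<open>P B (P Q u) = P (B \<inter> Q) u\<close>, so projecting the vector is the same as cutting
  its spectral measure off outside \<open>Q\<close>.
\<close>

lemma pvm_measure_restrict:
  assumes u: "u \<in> ell2" and Q: "Q \<in> sets borel"
  shows "pvm_measure P (P Q u) = density (pvm_measure P u) (\<lambda>t. ennreal (indicator Q t))"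
proof (rule measure_eqI)
  show "sets (pvm_measure P (P Q u)) = sets (density (pvm_measure P u) (\<lambda>t. ennreal (indicator Q t)))"
    by (simp add: sets_pvm_measure)
  fix B assume "B \<in> sets (pvm_measure P (P Q u))"
  then have B: "B \<in> sets borel" by (simp add: sets_pvm_measure)
  have "emeasure (density (pvm_measure P u) (\<lambda>t. ennreal (indicator Q t))) B
      = (\<integral>\<^sup>+ t. ennreal (indicator Q t) * indicator B t \<partial>pvm_measure P u)"
    using B Q by (subst emeasure_density)
      (simp_all add: sets_pvm_measure measurable_cong_sets[OF sets_pvm_measure refl])
  also have "\<dots> = (\<integral>\<^sup>+ t. indicator (B \<inter> Q) t \<partial>pvm_measure P u)"
    by (intro nn_integral_cong) (auto simp: indicator_def)
  also have "\<dots> = emeasure (pvm_measure P u) (B \<inter> Q)"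
    using B Q by (intro nn_integral_indicator) (auto simp: sets_pvm_measure)
  finally show "emeasure (pvm_measure P (P Q u)) B
      = emeasure (density (pvm_measure P u) (\<lambda>t. ennreal (indicator Q t))) B"
    using B Q u by (simp add: emeasure_pvm_measure pvm_ell2 pvm_Int)
qed

end

locale spectral_measure_of =
  fixes T :: "'a oper" and P :: "real set \<Rightarrow> 'a oper"
  assumes spectral: "is_spectral_measure T P"
    and T_ell2: "u \<in> ell2 \<Longrightarrow> T u \<in> ell2"
    and T_linear: "u \<in> ell2 \<Longrightarrow> v \<in> ell2 \<Longrightarrow>
      T (\<lambda>n. a * u n + b * v n) = (\<lambda>n. a * T u n + b * T v n)"
begin

lemma pvm: "projection_valued_measure P"
  using spectral by (simp add: is_spectral_measure_def)

lemmas P_ell2 = pvm_ell2[OF pvm]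

lemma borel_measurable_pvm: "borel_measurable (pvm_measure P u) = borel_measurable borel"
  by (rule measurable_cong_sets) (simp_all add: sets_pvm_measure[OF pvm])

lemma integrable_id:
  assumes u: "u \<in> ell2" shows "integrable (pvm_measure P u) (\<lambda>t. t)"
proof -
  interpret finite_measure "pvm_measure P u" by (rule finite_measure_pvm[OF pvm u])
  have "integrable (pvm_measure P u) (\<lambda>t. 1 + t\<^sup>2)"
    using spectral u by (auto simp: is_spectral_measure_def)
  then show ?thesis
  proof (rule Bochner_Integration.integrable_bound)
    show "AE t in pvm_measure P u. norm t \<le> norm (1 + t\<^sup>2)"
    proof (rule AE_I2)
      fix t :: real
      have "0 \<le> (\<bar>t\<bar> - 1)\<^sup>2" by simp
      then show "norm t \<le> norm (1 + t\<^sup>2)" by (simp add: power2_diff)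
    qed
  qed (simp add: borel_measurable_pvm)
qed

lemma form_eq_integral: "u \<in> ell2 \<Longrightarrow> l2_inner u (T u) = complex_of_real (\<integral>t. t \<partial>pvm_measure P u)"
  using spectral by (simp add: is_spectral_measure_def)

lemma form_restrict_eq_integral:
  assumes u: "u \<in> ell2" and Q: "Q \<in> sets borel"
  shows "l2_inner (P Q u) (T (P Q u)) = complex_of_real (\<integral>t. indicator Q t * t \<partial>pvm_measure P u)"
proof -
  have "(\<integral>t. t \<partial>pvm_measure P (P Q u)) = (\<integral>t. indicator Q t *\<^sub>R t \<partial>pvm_measure P u)"
    unfolding pvm_measure_restrict[OF pvm u Q]
    using Q by (intro integral_density) (auto simp: borel_measurable_pvm)
  then show ?thesis using form_eq_integral[OF P_ell2[OF Q u]] by simp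
qed

lemma integrable_indicator_id:
  "u \<in> ell2 \<Longrightarrow> Q \<in> sets borel \<Longrightarrow> integrable (pvm_measure P u) (\<lambda>t. indicator Q t * t)"
  using integrable_real_mult_indicator[of Q "pvm_measure P u", OF _ integrable_id]
  by (simp add: sets_pvm_measure[OF pvm] mult.commute)

text \<open>
  The first moment of the spectral measure of \<open>u\<close> is the sum of its parts over \<open>Q\<close> and over the
  complement, and these parts belong to the two projections of \<open>u\<close>.
\<close>

lemma form_split:
  assumes u: "u \<in> ell2" and Q: "Q \<in> sets borel"
  shows "l2_inner u (T u) = l2_inner (P Q u) (T (P Q u)) + l2_inner (P (- Q) u) (T (P (- Q) u))"
proof -
  have Q': "- Q \<in> sets borel" using Q by (auto simp: Compl_eq_Diff_UNIV)
  have "(\<integral>t. t \<partial>pvm_measure P u) = (\<integral>t. indicator Q t * t + indicator (- Q) t * t \<partial>pvm_measure P u)"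
    by (intro Bochner_Integration.integral_cong) (auto simp: indicator_def)
  also have "\<dots> = (\<integral>t. indicator Q t * t \<partial>pvm_measure P u) + (\<integral>t. indicator (- Q) t * t \<partial>pvm_measure P u)"
    by (intro Bochner_Integration.integral_add integrable_indicator_id u Q Q')
  finally show ?thesis
    unfolding form_restrict_eq_integral[OF u Q] form_restrict_eq_integral[OF u Q'] form_eq_integral[OF u]
    by simp
qed

text \<open>
  The spectral projections reduce \<open>T\<close>. The spectral measure describes only the quadratic form of
  \<open>T\<close>, so this is obtained by polarising \<open>form_split\<close>.
\<close>

lemma cross_term_zero:
  assumes u: "u \<in> ell2" and Q: "Q \<in> sets borel"
  shows "l2_inner (P Q u) (T (P (- Q) u)) = 0"
proof -
  have Q': "- Q \<in> sets borel" using Q by (auto simp: Compl_eq_Diff_UNIV)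
  define v where "v = P Q u"
  define w where "w = P (- Q) u"
  have v: "v \<in> ell2" and w: "w \<in> ell2" unfolding v_def w_def using P_ell2 u Q Q' by auto
  note Tv = T_ell2[OF v] and Tw = T_ell2[OF w]
  have proj: "P Q v = v" "P Q w = (\<lambda>n. 0)" "P (- Q) v = (\<lambda>n. 0)" "P (- Q) w = w"
    unfolding v_def w_def by (simp_all add: pvm_Int[OF pvm] pvm_empty[OF pvm] u Q Q')
  have *: "c * l2_inner v (T w) + cnj c * l2_inner w (T v) = 0" for c
  proof -
    define y where "y = (\<lambda>n. 1 * v n + c * w n)"
    have y: "y \<in> ell2" unfolding y_def using v w by (intro ell2_add ell2_scale)
    have PQ: "P Q y = v" "P (- Q) y = (\<lambda>n. c * w n)"
      unfolding y_def pvm_linear[OF pvm Q v w] pvm_linear[OF pvm Q' v w] by (simp_all add: proj)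
    have Ty: "T y = (\<lambda>n. T v n + c * T w n)"
      unfolding y_def T_linear[OF v w] by simp
    have Tcw: "T (\<lambda>n. c * w n) = (\<lambda>n. c * T w n)"
      using T_linear[OF w w, of c 0] by simp
    have "l2_inner y (T y) = l2_inner v (T v) + c * l2_inner v (T w) + cnj c * l2_inner w (T v)
        + cnj c * c * l2_inner w (T w)"
      unfolding Ty using v w Tv Tw
      by (simp add: y_def l2_inner_add_left l2_inner_add_right ell2_add ell2_scale
        l2_inner_scale_left l2_inner_scale_right algebra_simps)
    moreover have "l2_inner y (T y) = l2_inner v (T v) + cnj c * c * l2_inner w (T w)"
      unfolding form_split[OF y Q] PQ Tcw
      by (simp add: l2_inner_scale_left l2_inner_scale_right algebra_simps)
    ultimately show ?thesis by simp
  qed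
  \<comment> \<open>The choices \<open>c = 1\<close> and \<open>c = \<i>\<close> give the sum and the difference of the two cross terms.\<close>
  have "\<i> * (l2_inner v (T w) - l2_inner w (T v)) = 0"
    using *[of \<i>] by (simp add: algebra_simps)
  then show ?thesis using *[of 1] unfolding v_def w_def by simp
qed

text \<open>
  The part \<open>v\<close> of \<open>u\<close> with spectrum in \<open>Q\<close> satisfies \<open>\<langle>v, (T - E) u\<rangle> = \<langle>v, (T - E) v\<rangle>\<close>, and the right side
  has modulus at least \<open>\<delta> \<parallel>v\<parallel>\<^sup>2\<close> when \<open>Q\<close> lies on one side of \<open>E\<close> at distance \<open>\<delta>\<close>; the sign \<open>\<sigma>\<close>
  selects the side. Cauchy-Schwarz bounds the left side.
\<close>

lemma spectral_tail_bound:
  fixes \<sigma> :: real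
  assumes u: "u \<in> ell2" and Q: "Q \<in> sets borel" and \<sigma>: "\<bar>\<sigma>\<bar> = 1" and "\<delta> > 0"
    and away: "\<And>t. t \<in> Q \<Longrightarrow> \<delta> \<le> \<sigma> * (t - E)"
  shows "\<delta> * l2_norm (P Q u) \<le> l2_norm (\<lambda>n. T u n - of_real E * u n)"
proof -
  have Q': "- Q \<in> sets borel" using Q by (auto simp: Compl_eq_Diff_UNIV)
  define v where "v = P Q u"
  define w where "w = P (- Q) u"
  define e where "e = (\<lambda>n. T u n - of_real E * u n)"
  have v: "v \<in> ell2" and w: "w \<in> ell2" unfolding v_def w_def using P_ell2 u Q Q' by auto
  have e: "e \<in> ell2" unfolding e_def by (intro ell2_diff ell2_scale T_ell2 u)
  note Tv = T_ell2[OF v] and Tw = T_ell2[OF w]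
  have u_n: "u n = v n + w n" for n
    using pvm_union[OF pvm Q Q' _ u, of n] pvm_UNIV[OF pvm u] by (simp add: v_def w_def)
  have vw: "l2_inner v w = 0"
  proof -
    have "l2_inner v w = l2_inner u (P Q w)"
      unfolding v_def by (rule pvm_symmetric[OF pvm Q u w])
    also have "P Q w = (\<lambda>n. 0)"
      unfolding w_def pvm_Int[OF pvm Q Q' u] by (simp add: pvm_empty[OF pvm u])
    finally show ?thesis by (simp add: l2_inner_def)
  qed
  have "T u = (\<lambda>n. T v n + T w n)"
  proof -
    have "u = (\<lambda>n. v n + w n)" using u_n by (rule ext)
    then show ?thesis using T_linear[OF v w, of 1 1] by simp
  qed
  then have "e = (\<lambda>n. (T v n + T w n) - (of_real E * v n + of_real E * w n))"
    unfolding e_def by (simp add: u_n distrib_left)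
  then have "l2_inner v e = l2_inner v (T v) - of_real E * l2_inner v v"
    using v w Tv Tw cross_term_zero[OF u Q] vw unfolding v_def[symmetric] w_def[symmetric]
    by (simp add: l2_inner_diff_right l2_inner_add_right ell2_add ell2_scale l2_inner_scale_right)
  also have "l2_inner v (T v) = complex_of_real (\<integral>t. indicator Q t * t \<partial>pvm_measure P u)"
    unfolding v_def by (rule form_restrict_eq_integral[OF u Q])
  finally have inner: "l2_inner v e
      = complex_of_real ((\<integral>t. indicator Q t * t \<partial>pvm_measure P u) - E * (l2_norm v)\<^sup>2)"
    by (simp add: l2_inner_self[OF v])
  interpret finite_measure "pvm_measure P u" by (rule finite_measure_pvm[OF pvm u])
  have ind: "integrable (pvm_measure P u) (indicator Q :: real \<Rightarrow> real)"
    using Q by (intro integrable_real_indicator) (auto simp: sets_pvm_measure[OF pvm] emeasure_eq_measure)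
  have meas: "(\<integral>t. indicator Q t \<partial>pvm_measure P u) = (l2_norm v)\<^sup>2"
    using Q by (simp add: sets_pvm_measure[OF pvm] space_pvm_measure[OF pvm] measure_def
      emeasure_pvm_measure[OF pvm u Q] v_def)
  have "\<delta> * (l2_norm v)\<^sup>2 = (\<integral>t. \<delta> * indicator Q t \<partial>pvm_measure P u)"
    using meas by simp
  also have "\<dots> \<le> (\<integral>t. \<sigma> * (indicator Q t * t - E * indicator Q t) \<partial>pvm_measure P u)"
  proof (rule integral_mono)
    show "integrable (pvm_measure P u) (\<lambda>t. \<delta> * indicator Q t)"
      "integrable (pvm_measure P u) (\<lambda>t. \<sigma> * (indicator Q t * t - E * indicator Q t))"
      using ind integrable_indicator_id[OF u Q]
      by (intro Bochner_Integration.integrable_diff integrable_mult_right; simp)+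
  qed (use away in \<open>auto simp: indicator_def\<close>)
  also have "\<dots> = \<sigma> * ((\<integral>t. indicator Q t * t \<partial>pvm_measure P u) - E * (l2_norm v)\<^sup>2)"
    using ind integrable_indicator_id[OF u Q] meas by simp
  also have "\<dots> \<le> cmod (l2_inner v e)"
    unfolding inner norm_of_real using \<sigma> by (auto simp: abs_if split: if_splits)
  also have "\<dots> \<le> l2_norm v * l2_norm e" by (rule l2_cauchy_schwarz[OF v e])
  finally have "\<delta> * l2_norm v * l2_norm v \<le> l2_norm e * l2_norm v"
    by (simp add: power2_eq_square mult_ac)
  then have "\<delta> * l2_norm v \<le> l2_norm e"
    using l2_norm_nonneg[of v] l2_norm_nonneg[of e] by (cases "l2_norm v = 0") auto
  then show ?thesis by (simp add: v_def e_def)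
qed

text \<open>
  The complement of the interval consists of two half-lines, each on one side of \<open>E\<close> at distance at
  least \<open>\<delta>\<close>.
\<close>

lemma spectral_localization:
  assumes u: "u \<in> ell2" and "\<delta> > 0" "a \<le> E - \<delta>" "E + \<delta> \<le> b"
  shows "\<delta> * l2_norm (\<lambda>n. u n - P {a<..<b} u n) \<le> 2 * l2_norm (\<lambda>n. T u n - of_real E * u n)"
proof -
  have "u n = P {a<..<b} u n + (P {b..} u n + P {..a} u n)" for n
  proof -
    have "u n = P ({a<..<b} \<union> ({b..} \<union> {..a})) u n"
    proof -
      have "{a<..<b} \<union> ({b..} \<union> {..a}) = UNIV" by auto
      then show ?thesis using pvm_UNIV[OF pvm u] by simp
    qed
    also have "\<dots> = P {a<..<b} u n + P ({b..} \<union> {..a}) u n"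
      using u by (intro pvm_union[OF pvm]) auto
    also have "P ({b..} \<union> {..a}) u n = P {b..} u n + P {..a} u n"
      using u assms by (intro pvm_union[OF pvm]) auto
    finally show ?thesis .
  qed
  then have "(\<lambda>n. u n - P {a<..<b} u n) = (\<lambda>n. P {b..} u n + P {..a} u n)"
    by (auto simp: fun_eq_iff algebra_simps)
  then have "l2_norm (\<lambda>n. u n - P {a<..<b} u n) \<le> l2_norm (P {b..} u) + l2_norm (P {..a} u)"
    using l2_norm_triangle[OF P_ell2 P_ell2, OF _ u _ u, of "{b..}" "{..a}"] by simp
  then have "\<delta> * l2_norm (\<lambda>n. u n - P {a<..<b} u n) \<le> \<delta> * l2_norm (P {b..} u) + \<delta> * l2_norm (P {..a} u)"
    using \<open>\<delta> > 0\<close> by (simp add: distrib_left[symmetric])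
  moreover have "\<delta> * l2_norm (P {b..} u) \<le> l2_norm (\<lambda>n. T u n - of_real E * u n)"
    using assms by (intro spectral_tail_bound[where \<sigma> = 1]) auto
  moreover have "\<delta> * l2_norm (P {..a} u) \<le> l2_norm (\<lambda>n. T u n - of_real E * u n)"
    using assms by (intro spectral_tail_bound[where \<sigma> = "-1"]) auto
  ultimately show ?thesis by linarith
qed

end

section \<open>Translations and truncated plane waves\<close>

definition translate :: "'a::ab_group_add \<Rightarrow> 'a oper" where
  "translate s u = (\<lambda>n. u (n - s))"

lemma bij_minus_const: "bij (\<lambda>n. n - s :: 'a::ab_group_add)"
  by (rule bij_betw_byWitness[of _ "\<lambda>n. n + s"]) auto

lemma translate_ell2:
  assumes "u \<in> ell2" shows "translate s u \<in> ell2"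
  using assms unfolding ell2_def translate_def mem_Collect_eq
  by (subst summable_on_reindex_bij_betw[OF bij_minus_const, of "\<lambda>n. (cmod (u n))\<^sup>2"])

lemma l2_norm_translate: "l2_norm (translate s u) = l2_norm u"
  unfolding l2_norm_def translate_def
  by (subst infsum_reindex_bij_betw[OF bij_minus_const, of "\<lambda>n. (cmod (u n))\<^sup>2"]) (rule refl)

lemma l2_inner_translate: "l2_inner (translate s u) (translate t v) = l2_inner u (translate (t - s) v)"
proof -
  have "l2_inner (translate s u) (translate t v)
      = (\<Sum>\<^sub>\<infinity>n. cnj (u (n - s)) * v (n - s - (t - s)))"
    by (simp add: l2_inner_def translate_def)
  also have "\<dots> = (\<Sum>\<^sub>\<infinity>n. cnj (u n) * v (n - (t - s)))"
    by (rule infsum_reindex_bij_betw[OF bij_minus_const, of "\<lambda>n. cnj (u n) * v (n - (t - s))"])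
  finally show ?thesis by (simp add: l2_inner_def translate_def)
qed

lemma translate_compactly_supported:
  assumes "u \<in> compactly_supported" shows "translate s u \<in> compactly_supported"
proof -
  have "{n. translate s u n \<noteq> 0} = (\<lambda>n. n + s) ` {n. u n \<noteq> 0}"
    by (force simp: translate_def image_iff intro: exI[of _ "_ - s"])
  then show ?thesis using assms by (simp add: compactly_supported_def)
qed

text \<open>
  A finite combination of translations. On plane waves it acts as multiplication by the
  trigonometric polynomial called \<open>symbol\<close> below, which is a Laurent polynomial in the exponentials.
\<close>

definition laurent :: "'k set \<Rightarrow> ('k \<Rightarrow> complex) \<Rightarrow> ('k \<Rightarrow> 'a::ab_group_add) \<Rightarrow> 'a oper" where
  "laurent K c s u = (\<lambda>n. \<Sum>k\<in>K. c k * translate (s k) u n)"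

lemma laurent_ell2: "u \<in> ell2 \<Longrightarrow> laurent K c s u \<in> ell2"
  unfolding laurent_def by (intro ell2_sum ell2_scale translate_ell2)

lemma laurent_linear:
  "laurent K c s (\<lambda>n. a * u n + b * v n) = (\<lambda>n. a * laurent K c s u n + b * laurent K c s v n)"
  by (simp add: laurent_def translate_def algebra_simps sum.distrib sum_distrib_left)

lemma compactly_supported_sum:
  "finite K \<Longrightarrow> (\<And>k. k \<in> K \<Longrightarrow> U k \<in> compactly_supported) \<Longrightarrow>
    (\<lambda>n. \<Sum>k\<in>K. c k * U k n) \<in> compactly_supported"
  unfolding compactly_supported_def mem_Collect_eq
  by (rule finite_subset[of _ "\<Union>k\<in>K. {n. U k n \<noteq> 0}"]) (auto intro: ccontr dest: sum.not_neutral_contains_not_neutral)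

lemma laurent_compactly_supported:
  "finite K \<Longrightarrow> u \<in> compactly_supported \<Longrightarrow> laurent K c s u \<in> compactly_supported"
  unfolding laurent_def by (intro compactly_supported_sum translate_compactly_supported)

lemma l2_inner_laurent:
  "u \<in> ell2 \<Longrightarrow> l2_inner u (laurent K c s u) = (\<Sum>k\<in>K. c k * l2_inner u (translate (s k) u))"
  unfolding laurent_def
  by (simp add: l2_inner_sum_right ell2_scale translate_ell2 l2_inner_scale_right)

lemma l2_norm_laurent:
  assumes u: "u \<in> ell2"
  shows "complex_of_real ((l2_norm (laurent K c s u))\<^sup>2)
    = (\<Sum>k\<in>K. \<Sum>l\<in>K. cnj (c k) * c l * l2_inner u (translate (s l - s k) u))"
proof -
  have "complex_of_real ((l2_norm (laurent K c s u))\<^sup>2) = l2_inner (laurent K c s u) (laurent K c s u)"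
    by (simp only: l2_inner_self[OF laurent_ell2[OF u]])
  also have "\<dots> = (\<Sum>k\<in>K. l2_inner (\<lambda>n. c k * translate (s k) u n) (laurent K c s u))"
    by (subst laurent_def) (intro l2_inner_sum_left laurent_ell2 ell2_scale translate_ell2 u)
  also have "\<dots> = (\<Sum>k\<in>K. \<Sum>l\<in>K. cnj (c k) * c l * l2_inner u (translate (s l - s k) u))"
    unfolding laurent_def
    by (simp add: l2_inner_sum_right ell2_scale translate_ell2 u l2_inner_scale_right
        l2_inner_scale_left l2_inner_translate sum_distrib_left mult_ac)
  finally show ?thesis .
qed

definition vec2 :: "'a \<Rightarrow> 'a \<Rightarrow> 'a ^ 2" where "vec2 p q = (\<chi> i. if i = 1 then p else q)"

lemma vec2_nth [simp]: "vec2 p q $ 1 = p" "vec2 p q $ 2 = q"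
  by (simp_all add: vec2_def)

lemma vec2_eq_iff: "n = m \<longleftrightarrow> n $ 1 = m $ 1 \<and> n $ (2::2) = m $ 2"
  by (auto simp: vec_eq_iff forall_2)

lemma vec2_exhaust: obtains p q where "n = vec2 p q"
  by (metis vec2_eq_iff vec2_nth)

text \<open>
  Explicit coordinates turn identities between shifted values of a sequence into ring identities.
\<close>

lemma vec2_diff_axis [simp]:
  "vec2 p q - axis 1 r = vec2 (p - r) (q :: int)" "vec2 p q - axis 2 r = vec2 p (q - r :: int)"
  by (simp_all add: vec2_eq_iff[of "_ - _"] axis_def)

lemma vec2_diff [simp]: "vec2 p q - vec2 r s = vec2 (p - r) (q - s :: int)"
  by (simp add: vec2_eq_iff[of "_ - _"])

lemma vec2_inject [simp]: "vec2 p q = vec2 r s \<longleftrightarrow> p = r \<and> q = s"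
  by (simp add: vec2_eq_iff)

definition wave :: "real \<Rightarrow> real \<Rightarrow> nat \<Rightarrow> int ^ 2 \<Rightarrow> complex" where
  "wave a b L n = (if n $ 1 \<in> {0..<int L} \<and> n $ 2 \<in> {0..<int L}
     then cis (a * of_int (n $ 1) + b * of_int (n $ 2)) / of_nat L else 0)"

text \<open>
  For \<open>L > 0\<close>, the fraction of the box of side \<open>L\<close> that its translate by \<open>s\<close> covers.
\<close>

definition overlap_weight :: "int ^ 2 \<Rightarrow> nat \<Rightarrow> real" where
  "overlap_weight s L = max 0 (1 - of_int \<bar>s $ 1\<bar> / L) * max 0 (1 - of_int \<bar>s $ 2\<bar> / L)"

lemma box_eq_image:
  "{n :: int^2. n $ 1 \<in> A \<and> n $ 2 \<in> B} = (\<lambda>(p, q). vec2 p q) ` (A \<times> B)"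
proof (intro set_eqI iffI)
  fix n assume "n \<in> {n :: int^2. n $ 1 \<in> A \<and> n $ 2 \<in> B}"
  then show "n \<in> (\<lambda>(p, q). vec2 p q) ` (A \<times> B)"
    by (cases n rule: vec2_exhaust) auto
qed auto

lemma inj_vec2: "inj_on (\<lambda>(p, q). vec2 p q) S"
  by (auto simp: inj_on_def)

lemma wave_compactly_supported: "wave a b L \<in> compactly_supported"
proof -
  have "{n. wave a b L n \<noteq> 0} \<subseteq> {n. n $ 1 \<in> {0..<int L} \<and> n $ 2 \<in> {0..<int L}}"
    by (auto simp: wave_def split: if_splits)
  then show ?thesis
    unfolding compactly_supported_def mem_Collect_eq box_eq_image by (rule finite_subset) auto
qed

text \<open>
  Where the box and its translate overlap, the phases cancel up to a constant. What remains is the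
  fraction of the box that is covered by the translate, a product of the two side fractions.
\<close>

lemma wave_overlap:
  assumes L: "L > 0"
  shows "l2_inner (wave a b L) (translate s (wave a b L))
    = cis (- (a * of_int (s $ 1) + b * of_int (s $ 2))) * of_real (overlap_weight s L)"
proof -
  define I :: "int \<Rightarrow> int set" where "I r = {max 0 r..<min (int L) (int L + r)}" for r
  define z where "z = cis (- (a * of_int (s $ 1) + b * of_int (s $ 2)))"
  have card_I: "of_nat (card (I r)) / of_nat L = complex_of_real (max 0 (1 - of_int \<bar>r\<bar> / L))" for r
  proof -
    have "min (int L) (int L + r) - max 0 r = int L - \<bar>r\<bar>" by auto
    then have "card (I r) = nat (int L - \<bar>r\<bar>)" by (simp add: I_def)
    then have "real (card (I r)) = max 0 (real L - of_int \<bar>r\<bar>)" by (simp add: of_nat_nat max_def)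
    also have "\<dots> / L = max 0 (1 - of_int \<bar>r\<bar> / L)"
      using L by (auto simp: max_def field_simps)
    finally have "complex_of_real (real (card (I r)) / L) = complex_of_real (max 0 (1 - of_int \<bar>r\<bar> / L))" 
      by simp
    then show ?thesis by simp
  qed
  have summand: "cnj (wave a b L n) * translate s (wave a b L) n
      = (if n $ 1 \<in> I (s $ 1) \<and> n $ 2 \<in> I (s $ 2) then z / of_nat L ^ 2 else 0)" for n
  proof (cases "n $ 1 \<in> I (s $ 1) \<and> n $ 2 \<in> I (s $ 2)")
    case True
    then have "wave a b L n = cis (a * of_int (n $ 1) + b * of_int (n $ 2)) / of_nat L"
      "translate s (wave a b L) n = cis (a * of_int (n $ 1 - s $ 1) + b * of_int (n $ 2 - s $ 2)) / of_nat L"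
      by (auto simp: wave_def translate_def I_def)
    then show ?thesis using True
      by (simp add: cis_cnj cis_mult z_def power2_eq_square algebra_simps)
  next
    case False
    then have "wave a b L n = 0 \<or> translate s (wave a b L) n = 0"
      by (auto simp: wave_def translate_def I_def)
    with False show ?thesis by auto
  qed
  have "l2_inner (wave a b L) (translate s (wave a b L))
      = (\<Sum>\<^sub>\<infinity>n\<in>{n :: int^2. n $ 1 \<in> I (s $ 1) \<and> n $ 2 \<in> I (s $ 2)}. z / of_nat L ^ 2)"
    unfolding l2_inner_def summand by (intro infsum_cong_neutral) auto
  also have "\<dots> = of_nat (card (I (s $ 1))) * of_nat (card (I (s $ 2))) * (z / of_nat L ^ 2)"
    unfolding box_eq_image by (simp add: I_def card_image[OF inj_vec2] card_cartesian_product)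
  also have "\<dots> = z * ((of_nat (card (I (s $ 1))) / of_nat L) * (of_nat (card (I (s $ 2))) / of_nat L))"
    by (simp add: power2_eq_square)
  finally show ?thesis by (simp only: card_I z_def overlap_weight_def of_real_mult)
qed

lemma overlap_weight_tendsto: "overlap_weight s \<longlonglongrightarrow> 1"
proof -
  have "(\<lambda>L. max 0 (1 - c / real L)) \<longlonglongrightarrow> max 0 (1 - 0)" for c :: real
    by (intro tendsto_max tendsto_diff tendsto_const lim_const_over_n)
  from tendsto_mult[OF this this] show ?thesis
    unfolding overlap_weight_def by simp
qed

lemma wave_overlap_tendsto:
  "(\<lambda>L. l2_inner (wave a b L) (translate s (wave a b L)))
    \<longlonglongrightarrow> cis (- (a * of_int (s $ 1) + b * of_int (s $ 2)))" (is "_ \<longlonglongrightarrow> ?z")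
proof (rule Lim_transform_eventually)
  show "(\<lambda>L. ?z * of_real (overlap_weight s L)) \<longlonglongrightarrow> ?z"
    using tendsto_mult[OF tendsto_const tendsto_of_real[OF overlap_weight_tendsto]] by simp
  show "\<forall>\<^sub>F L in sequentially. ?z * of_real (overlap_weight s L)
      = l2_inner (wave a b L) (translate s (wave a b L))"
    using eventually_gt_at_top[of 0] by eventually_elim (simp add: wave_overlap)
qed

lemma wave_norm: "L > 0 \<Longrightarrow> l2_norm (wave a b L) = 1"
proof -
  assume "L > 0"
  then have "l2_inner (wave a b L) (translate 0 (wave a b L)) = 1"
    by (simp add: wave_overlap overlap_weight_def)
  then have "complex_of_real ((l2_norm (wave a b L))\<^sup>2) = of_real 1"
    unfolding l2_inner_self[OF compactly_supported_ell2[OF wave_compactly_supported], symmetric]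
    by (simp add: translate_def)
  then have "(l2_norm (wave a b L))\<^sup>2 = 1" by (simp only: of_real_eq_iff)
  then show ?thesis using l2_norm_nonneg[of "wave a b L"] by (simp add: power2_eq_1_iff)
qed

definition symbol :: "real \<Rightarrow> real \<Rightarrow> 'k set \<Rightarrow> ('k \<Rightarrow> complex) \<Rightarrow> ('k \<Rightarrow> int ^ 2) \<Rightarrow> complex" where
  "symbol a b K c s = (\<Sum>k\<in>K. c k * cis (- (a * of_int (s k $ 1) + b * of_int (s k $ 2))))"

lemma wave_ell2: "wave a b L \<in> ell2"
  by (rule compactly_supported_ell2[OF wave_compactly_supported])

lemma wave_laurent_tendsto:
  "(\<lambda>L. l2_inner (wave a b L) (laurent K c s (wave a b L))) \<longlonglongrightarrow> symbol a b K c s"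
  unfolding l2_inner_laurent[OF wave_ell2] symbol_def
  by (intro tendsto_sum tendsto_mult tendsto_const wave_overlap_tendsto)

text \<open>
  The squared norm expands into overlaps of pairs of translates, so in the limit it is the double sum
  of products of phases, which factors.
\<close>

lemma wave_laurent_norm_tendsto:
  "(\<lambda>L. (l2_norm (laurent K c s (wave a b L)))\<^sup>2) \<longlonglongrightarrow> (cmod (symbol a b K c s))\<^sup>2"
proof -
  have "(\<lambda>L. complex_of_real ((l2_norm (laurent K c s (wave a b L)))\<^sup>2)) \<longlonglongrightarrow>
    (\<Sum>k\<in>K. \<Sum>l\<in>K. cnj (c k) * c l *
        cis (- (a * of_int ((s l - s k) $ 1) + b * of_int ((s l - s k) $ 2))))"
    unfolding l2_norm_laurent[OF wave_ell2]
    by (intro tendsto_sum tendsto_mult tendsto_const wave_overlap_tendsto)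
  also have "(\<Sum>k\<in>K. \<Sum>l\<in>K. cnj (c k) * c l *
        cis (- (a * of_int ((s l - s k) $ 1) + b * of_int ((s l - s k) $ 2))))
      = (\<Sum>k\<in>K. \<Sum>l\<in>K. cnj (c k * cis (- (a * of_int (s k $ 1) + b * of_int (s k $ 2)))) *
          (c l * cis (- (a * of_int (s l $ 1) + b * of_int (s l $ 2)))))"
  proof (intro sum.cong refl)
    fix k l
    have "cis (- (a * of_int ((s l - s k) $ 1) + b * of_int ((s l - s k) $ 2)))
      = cnj (cis (- (a * of_int (s k $ 1) + b * of_int (s k $ 2))))
        * cis (- (a * of_int (s l $ 1) + b * of_int (s l $ 2)))"
      unfolding cis_cnj cis_mult by (simp add: algebra_simps)
    then show "cnj (c k) * c l * cis (- (a * of_int ((s l - s k) $ 1) + b * of_int ((s l - s k) $ 2)))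
      = cnj (c k * cis (- (a * of_int (s k $ 1) + b * of_int (s k $ 2)))) *
          (c l * cis (- (a * of_int (s l $ 1) + b * of_int (s l $ 2))))"
      by simp
  qed
  also have "\<dots> = cnj (symbol a b K c s) * symbol a b K c s"
    by (simp add: symbol_def sum_product)
  also have "\<dots> = complex_of_real ((cmod (symbol a b K c s))\<^sup>2)"
    by (simp only: complex_norm_square mult.commute)
  finally show ?thesis unfolding tendsto_of_real_iff .
qed

section \<open>The commutator with a combination of conjugate operators\<close>

abbreviation signs :: "int set" where "signs \<equiv> {-1, 1}"

abbreviation MV_translation :: "int \<times> int \<Rightarrow> int ^ 2" where
  "MV_translation \<equiv> \<lambda>(p, q). vec2 p q"

lemma MV_vec2: "MV u (vec2 p q)
  = (u (vec2 (p - 1) (q - 1)) + u (vec2 (p - 1) (q + 1)) + u (vec2 (p + 1) (q - 1)) + u (vec2 (p + 1) (q + 1))) / 4"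
  by (simp add: MV_2 Delta_def shift_def) (simp add: field_simps)

lemma MV_eq_laurent: "MV = laurent (signs \<times> signs) (\<lambda>_. 1 / 4) MV_translation"
proof (intro ext)
  fix u :: "int^2 \<Rightarrow> complex" and n
  show "MV u n = laurent (signs \<times> signs) (\<lambda>_. 1 / 4) MV_translation u n"
    by (cases n rule: vec2_exhaust)
      (simp add: MV_vec2 laurent_def translate_def sum.cartesian_product[symmetric] field_simps)
qed

lemma MV_symbol: "symbol a b (signs \<times> signs) (\<lambda>_. 1 / 4) MV_translation = of_real (cos a * cos b)"
  by (simp add: symbol_def sum.cartesian_product[symmetric] complex_eq_iff cos_add sin_add cos_diff sin_diff field_simps)

text \<open>
  The difference expression of \<open>A\<^sub>m\<close>: each value depends on finitely many values of the argument,
  so it makes sense on arbitrary sequences.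
\<close>

definition conj_local :: "nat \<Rightarrow> (int^2) oper" where
  "conj_local m u n = (\<Sum>i\<in>UNIV. ((2 * of_int (n $ i) - of_nat m) * u (n - axis i (int m))
      - (2 * of_int (n $ i) + of_nat m) * u (n - axis i (- int m))) / (4 * \<i>))"

lemma conj_local_vec2: "conj_local m u (vec2 p q) =
   (((2 * of_int p - of_nat m) * u (vec2 (p - int m) q) - (2 * of_int p + of_nat m) * u (vec2 (p + int m) q))
  + ((2 * of_int q - of_nat m) * u (vec2 p (q - int m)) - (2 * of_int q + of_nat m) * u (vec2 p (q + int m)))) / (4 * \<i>)"
  unfolding conj_local_def sum_2 add_divide_distrib by simp

text \<open>
  An operator that is continuous for pointwise convergence keeps its formula under closure in
  \<open>ell2\<close>, because norm convergence implies pointwise convergence.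
\<close>

lemma graph_closure_single_valued:
  assumes "(u, w) \<in> graph_closure {(u, F u) |u. u \<in> D}"
    and cont: "\<And>U u n. (\<And>k. (\<lambda>j. U j k) \<longlonglongrightarrow> u k) \<Longrightarrow> (\<lambda>j. F (U j) n) \<longlonglongrightarrow> F u n"
  shows "w = F u"
proof
  fix n
  obtain U W where UW: "\<And>k. W k = F (U k)" "l2_tendsto U u" "l2_tendsto W w"
    using assms(1) unfolding graph_closure_def by blast
  have "(\<lambda>j. F (U j) n) \<longlonglongrightarrow> F u n"
    by (intro cont l2_tendsto_pointwise UW(2))
  moreover have "(\<lambda>j. F (U j) n) \<longlonglongrightarrow> w n"
    using l2_tendsto_pointwise[OF UW(3)] UW(1) by simp
  ultimately show "w n = F u n" by (rule LIMSEQ_unique[symmetric])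
qed

lemma conj_comp_unique:
  assumes "(u, w) \<in> conj_comp i m"
  shows "w n = ((2 * of_int (n $ i) - of_nat m) * u (n - axis i (int m))
      - (2 * of_int (n $ i) + of_nat m) * u (n - axis i (- int m))) / (4 * \<i>)"
proof -
  have "w = (\<lambda>n. (shift_diff i m (position i u) n + position i (shift_diff i m u) n) / (4 * \<i>))"
  proof (rule graph_closure_single_valued[where D = compactly_supported and
        F = "\<lambda>u n. (shift_diff i m (position i u) n + position i (shift_diff i m u) n) / (4 * \<i>)"])
    show "(u, w) \<in> graph_closure {(u, \<lambda>n. (shift_diff i m (position i u) n + position i (shift_diff i m u) n)
        / (4 * \<i>)) |u. u \<in> compactly_supported}"
      using assms by (simp add: conj_comp_def)
  qed (auto simp: shift_diff_def position_def shift_def intro!: tendsto_intros)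
  then show ?thesis
    by (simp add: shift_diff_def position_def shift_def axis_def algebra_simps)
qed

lemma conj_op_unique:
  assumes "(u, w) \<in> conj_op m" shows "w = conj_local m u"
proof -
  obtain v where v: "\<And>i. (u, v i) \<in> conj_comp i m" "w = (\<lambda>n. \<Sum>i\<in>UNIV. v i n)"
    using assms by (auto simp: conj_op_def)
  then show ?thesis unfolding conj_local_def by (simp only: v(2) conj_comp_unique[OF v(1)])
qed

lemma lin_comb_core_tendsto:
  assumes "(u, w) \<in> lin_comb_core \<kappa> \<rho>"
  shows "(\<lambda>J. \<Sum>j = 1..J. of_real (\<rho> j) * conj_local (j * \<kappa>) u n) \<longlonglongrightarrow> w n"
proof -
  obtain v where v: "\<And>j. j \<ge> 1 \<Longrightarrow> (u, v j) \<in> conj_op (j * \<kappa>)"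
    "l2_tendsto (\<lambda>J n. \<Sum>j = 1..J. of_real (\<rho> j) * v j n) w"
    using assms by (auto simp: lin_comb_core_def)
  have "(\<Sum>j = 1..J. of_real (\<rho> j) * v j n) = (\<Sum>j = 1..J. of_real (\<rho> j) * conj_local (j * \<kappa>) u n)" for J
    by (intro sum.cong refl) (simp add: conj_op_unique[OF v(1)])
  then show ?thesis using l2_tendsto_pointwise[OF v(2), of n] by simp
qed

lemma lin_comb_core_ell2:
  "(u, w) \<in> lin_comb_core \<kappa> \<rho> \<Longrightarrow> u \<in> compactly_supported \<and> w \<in> ell2"
  by (auto simp: lin_comb_core_def l2_tendsto_def)

lemma lin_comb_core_subset: "lin_comb_core \<kappa> \<rho> \<subseteq> lin_comb \<kappa> \<rho>"
proof
  fix z :: "(int^'d \<Rightarrow> complex) \<times> (int^'d \<Rightarrow> complex)"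
  assume z: "z \<in> lin_comb_core \<kappa> \<rho>"
  obtain u w where uw: "z = (u, w)" by (cases z)
  have "l2_tendsto (\<lambda>_. u) u" "l2_tendsto (\<lambda>_. w) w"
    using lin_comb_core_ell2[OF z[unfolded uw]] compactly_supported_ell2[of u]
    by (auto simp: l2_tendsto_def l2_norm_def)
  then show "z \<in> lin_comb \<kappa> \<rho>"
    using z unfolding uw lin_comb_def graph_closure_def
    by (intro CollectI case_prodI exI[of _ "\<lambda>_. u"] exI[of _ "\<lambda>_. w"] conjI allI)
qed

lemma delta_compactly_supported: "(\<lambda>n. if n = k then 1 else 0) \<in> compactly_supported"
  by (simp add: compactly_supported_def)

lemma l2_inner_delta: "l2_inner v (\<lambda>n. if n = k then 1 else 0) = cnj (v k)"
proof -
  have "l2_inner v (\<lambda>n. if n = k then 1 else 0) = (\<Sum>\<^sub>\<infinity>n\<in>{k}. cnj (v n))"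
    unfolding l2_inner_def by (intro infsum_cong_neutral) auto
  then show ?thesis by simp
qed

text \<open>
  Since \<open>A\<close> equals its adjoint, the value \<open>v n\<close> is the inner product of \<open>v\<close> with a point mass and
  hence determined by \<open>u\<close> and the action of \<open>A\<close> on that point mass.
\<close>

lemma self_adjoint_single_valued:
  assumes A: "self_adjoint A" and dom: "compactly_supported \<subseteq> Domain A"
    and "(u, v) \<in> A" "(u, w) \<in> A"
  shows "v = w"
proof
  fix n
  define \<delta> :: "'a \<Rightarrow> complex" where "\<delta> = (\<lambda>k. if k = n then 1 else 0)"
  have "\<delta> \<in> Domain A"
    unfolding \<delta>_def by (rule subsetD[OF dom delta_compactly_supported])
  then obtain y where y: "(\<delta>, y) \<in> A" by (rule DomainE)
  have "l2_inner x \<delta> = l2_inner u y" if "(u, x) \<in> A" for x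
  proof -
    have "(u, x) \<in> graph_adjoint A" using A that by (simp add: self_adjoint_def)
    then show ?thesis using y by (auto simp: graph_adjoint_def)
  qed
  from this[OF assms(3)] this[OF assms(4)] have "l2_inner v \<delta> = l2_inner w \<delta>" by simp
  then show "v n = w n" by (simp add: \<delta>_def l2_inner_delta)
qed

text \<open>
  The image of the point mass at the origin has the value \<open>\<rho>\<^sub>j j\<kappa> / 4i\<close> at distance \<open>j\<kappa>\<close> along the
  first axis. Its square summability gives \<open>\<Sum>\<^sub>j (j \<rho>\<^sub>j)\<^sup>2 < \<infinity>\<close>, and comparison with
  \<open>\<Sum>\<^sub>j 1/j\<^sup>2\<close> gives absolute summability of the coefficients. This is what makes infinite
  combinations as harmless as finite ones.
\<close>

lemma coefficients_summable:
  assumes "\<kappa> \<ge> 1" and dom: "compactly_supported \<subseteq> Domain (lin_comb_core \<kappa> \<rho> :: (int^2) graph)"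
  shows "summable (\<lambda>j. \<bar>\<rho> (Suc j)\<bar>)"
proof -
  define \<delta> :: "int^2 \<Rightarrow> complex" where "\<delta> = (\<lambda>k. if k = vec2 0 0 then 1 else 0)"
  have "\<delta> \<in> Domain (lin_comb_core \<kappa> \<rho> :: (int^2) graph)"
    unfolding \<delta>_def by (rule subsetD[OF dom delta_compactly_supported])
  then obtain w where w: "(\<delta>, w) \<in> lin_comb_core \<kappa> \<rho>" by (rule DomainE)
  have w_at: "w (vec2 (int (j * \<kappa>)) 0) = of_real (\<rho> j) * of_nat (j * \<kappa>) / (4 * \<i>)" if "j \<ge> 1" for j
  proof -
    have loc: "conj_local (i * \<kappa>) \<delta> (vec2 (int (j * \<kappa>)) 0) = (if i = j then of_nat (j * \<kappa>) / (4 * \<i>) else 0)" for i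
    proof -
      have "int (j * \<kappa>) > 0" using \<open>j \<ge> 1\<close> \<open>\<kappa> \<ge> 1\<close> by simp
      moreover have "int (j * \<kappa>) - int (i * \<kappa>) = 0 \<longleftrightarrow> i = j" using \<open>\<kappa> \<ge> 1\<close> by auto
      moreover have "int (j * \<kappa>) + int (i * \<kappa>) \<noteq> 0"
        using \<open>int (j * \<kappa>) > 0\<close> of_nat_0_le_iff[of "i * \<kappa>", where 'a = int] by linarith
      ultimately show ?thesis unfolding conj_local_vec2 \<delta>_def by auto
    qed
    have "(\<Sum>i = 1..J. of_real (\<rho> i) * conj_local (i * \<kappa>) \<delta> (vec2 (int (j * \<kappa>)) 0))
        = of_real (\<rho> j) * of_nat (j * \<kappa>) / (4 * \<i>)" if "J \<ge> j" for J
      using that \<open>j \<ge> 1\<close> unfolding loc by (simp add: if_distrib[of "\<lambda>x. _ * x"] cong: if_cong)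
    then have "(\<lambda>J. \<Sum>i = 1..J. of_real (\<rho> i) * conj_local (i * \<kappa>) \<delta> (vec2 (int (j * \<kappa>)) 0))
        \<longlonglongrightarrow> of_real (\<rho> j) * of_nat (j * \<kappa>) / (4 * \<i>)"
      by (intro tendsto_eventually) (auto simp: eventually_sequentially)
    then show ?thesis using lin_comb_core_tendsto[OF w] LIMSEQ_unique by blast
  qed
  have "(\<lambda>n. (cmod (w n))\<^sup>2) summable_on range (\<lambda>j. vec2 (int (Suc j * \<kappa>)) 0)"
    using lin_comb_core_ell2[OF w] by (intro summable_on_subset_banach[OF ell2_square_summable]) auto
  moreover have "inj (\<lambda>j. vec2 (int (Suc j * \<kappa>)) 0)"
    using \<open>\<kappa> \<ge> 1\<close> by (auto simp: inj_on_def simp del: of_nat_Suc of_nat_mult)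
  ultimately have "(\<lambda>j. (cmod (w (vec2 (int (Suc j * \<kappa>)) 0)))\<^sup>2) summable_on UNIV"
    by (simp add: summable_on_reindex o_def)
  then have "summable (\<lambda>j. (cmod (w (vec2 (int (Suc j * \<kappa>)) 0)))\<^sup>2)"
    by (simp add: summable_on_UNIV_nonneg_real_iff)
  then have *: "summable (\<lambda>j. (\<rho> (Suc j) * real (Suc j * \<kappa>) / 4)\<^sup>2)"
    by (simp only: w_at norm_mult norm_divide norm_of_real norm_of_nat)
       (simp add: power_mult_distrib power_divide)
  \<comment> \<open>The estimate \<open>x \<le> (x k)\<^sup>2 + k\<^sup>-\<^sup>2\<close>; the factor 16 undoes the denominator \<open>4\<i>\<close>.\<close>
  have "summable (\<lambda>j. inverse ((real (Suc j))\<^sup>2))"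
    using inverse_power_summable[of 2, where 'a = real] by (subst summable_Suc_iff) simp_all
  then have "summable (\<lambda>j. 16 * (\<rho> (Suc j) * real (Suc j * \<kappa>) / 4)\<^sup>2 + inverse ((real (Suc j))\<^sup>2))"
    by (intro summable_add summable_mult *)
  then show ?thesis
  proof (rule summable_comparison_test')
    fix j
    define x where "x = \<bar>\<rho> (Suc j)\<bar>"
    define k where "k = real (Suc j)"
    have k: "k > 0" by (simp add: k_def)
    have "x = (x * k) * inverse k" using k by simp
    also have "\<dots> \<le> ((x * k)\<^sup>2 + (inverse k)\<^sup>2)"
    proof -
      have "0 \<le> x * k * inverse k" using k by (simp add: x_def)
      then show ?thesis using sum_squares_bound[of "x * k" "inverse k"] unfolding mult.assoc[of 2] by linarith
    qed
    also have "(x * k)\<^sup>2 \<le> (x * (k * real \<kappa>))\<^sup>2"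
      using k \<open>\<kappa> \<ge> 1\<close> by (intro power_mono mult_left_mono) (auto simp: x_def)
    finally show "norm \<bar>\<rho> (Suc j)\<bar> \<le> 16 * (\<rho> (Suc j) * real (Suc j * \<kappa>) / 4)\<^sup>2 + inverse ((real (Suc j))\<^sup>2)"
      by (simp add: x_def k_def power_mult_distrib power_divide power_inverse del: of_nat_Suc mult_Suc)
  qed
qed

type_synonym comm_index = "bool \<times> int \<times> int \<times> int"

abbreviation comm_indices :: "comm_index set" where
  "comm_indices \<equiv> UNIV \<times> signs \<times> signs \<times> signs"

text \<open>
  The commutator \<open>[D, i A\<^sub>m]\<close> is
  \<open>(S\<^sub>1\<^sup>m - S\<^sub>1\<^sup>-\<^sup>m)(S\<^sub>1\<^sup>-\<^sup>1 - S\<^sub>1) \<Delta>\<^sub>2 / 4\<close> plus the same with the coordinates exchanged.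
  An index consists of a flag for the coordinate and one sign for each of the three factors.
\<close>

abbreviation comm_coeff :: "comm_index \<Rightarrow> complex" where
  "comm_coeff \<equiv> \<lambda>(c, \<sigma>, \<tau>, q). - of_int (\<sigma> * \<tau>) / 8"

abbreviation comm_translation :: "nat \<Rightarrow> comm_index \<Rightarrow> int ^ 2" where
  "comm_translation m \<equiv> \<lambda>(c, \<sigma>, \<tau>, q). if c then vec2 (\<sigma> * int m + \<tau>) q else vec2 q (\<sigma> * int m + \<tau>)"

definition comm_local :: "nat \<Rightarrow> (int^2) oper" where
  "comm_local m = laurent comm_indices comm_coeff (comm_translation m)"

lemma commutator_conj_local:
  "\<i> * (MV (conj_local m u) n - conj_local m (MV u) n) = comm_local m u n"
proof (cases n rule: vec2_exhaust)
  case (1 p q)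
  show ?thesis
    unfolding 1
    by (simp add: MV_vec2 conj_local_vec2 comm_local_def laurent_def translate_def
        sum.cartesian_product[symmetric] UNIV_bool field_simps)
qed

lemma comm_symbol:
  "symbol a b comm_indices comm_coeff (comm_translation m)
    = of_real (cos b * (sin a * sin (real m * a)) + cos a * (sin b * sin (real m * b)))"
  by (simp add: symbol_def sum.cartesian_product[symmetric] UNIV_bool complex_eq_iff
      cos_add sin_add cos_diff sin_diff field_simps)

lemma g_fun_cos:
  assumes "m \<ge> 1"
  shows "g_fun m (vec2 (cos a) (cos b)) = cos b * (sin a * sin (real m * a)) + cos a * (sin b * sin (real m * b))"
proof -
  have *: "(1 - (cos t)\<^sup>2) * cheb_U (m - 1) (cos t) = sin t * sin (real m * t)" for t
  proof -
    have "1 - (cos t)\<^sup>2 = sin t * sin t"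
      using sin_squared_eq[of t] by (simp add: power2_eq_square)
    moreover have "cheb_U (m - 1) (cos t) * sin t = sin (real m * t)"
      using cheb_U_cos[of "m - 1" t] assms by simp
    ultimately show ?thesis by (simp only: mult_ac)
  qed
  have "UNIV - {1} = {2 :: 2}" "UNIV - {2} = {1 :: 2}" 
    by (auto simp: set_eq_iff forall_2)
  then show ?thesis
    unfolding g_fun_def sum_2 by (simp add: mult.assoc *[unfolded One_nat_def])
qed

section \<open>Linear dependence on the energy surface gives thresholds\<close>

text \<open>
  Self-adjointness makes the action of \<open>A\<close> on compactly supported sequences unambiguous, hence equal
  to the pointwise convergent series. The Laplacian couples finitely many sites, so the commutator can
  be taken term by term.
\<close>

lemma commutator_series:
  assumes "\<kappa> \<ge> 1" and A: "selfadjoint_lin_comb \<kappa> A" and B: "is_commutator (MV :: (int^2) oper) A B"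
  obtains \<rho> :: "nat \<Rightarrow> real" where "summable (\<lambda>j. \<bar>\<rho> j\<bar>)"
    and "\<And>u n. u \<in> compactly_supported \<Longrightarrow>
      (\<lambda>j. of_real (\<rho> j) * comm_local (Suc j * \<kappa>) u n) sums B u n"
proof -
  obtain \<rho> where dom: "compactly_supported \<subseteq> Domain (lin_comb_core \<kappa> \<rho> :: (int^2) graph)"
    and A_eq: "A = lin_comb \<kappa> \<rho>" and sa: "self_adjoint A"
    using A by (auto simp: selfadjoint_lin_comb_def)
  have domA: "compactly_supported \<subseteq> Domain A"
    using dom Domain_mono[OF lin_comb_core_subset[of \<kappa> \<rho>]] unfolding A_eq by (rule order_trans)
  have action: "(\<lambda>J. \<Sum>j = 1..J. of_real (\<rho> j) * conj_local (j * \<kappa>) u n) \<longlonglongrightarrow> v n"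
    if uv: "(u, v) \<in> A" and u: "u \<in> compactly_supported" for u v n
  proof -
    obtain w where w: "(u, w) \<in> lin_comb_core \<kappa> \<rho>"
      using subsetD[OF dom u] by (rule DomainE)
    then have "(u, w) \<in> A" using lin_comb_core_subset unfolding A_eq by blast
    then have "w = v" by (rule self_adjoint_single_valued[OF sa domA _ uv])
    then show ?thesis using lin_comb_core_tendsto[OF w] by simp
  qed
  have series: "(\<lambda>J. \<Sum>j = 1..J. of_real (\<rho> j) * comm_local (j * \<kappa>) u n) \<longlonglongrightarrow> B u n"
    if u: "u \<in> compactly_supported" for u n
  proof -
    obtain v w where v: "(u, v) \<in> A" and w: "(MV u, w) \<in> A"
      and Bu: "B u = (\<lambda>n. \<i> * (MV v n - w n))"
      using B u unfolding is_commutator_def by blast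
    have MVu: "MV u \<in> compactly_supported"
      unfolding MV_eq_laurent by (intro laurent_compactly_supported u) simp
    have "(\<lambda>J. laurent (signs \<times> signs) (\<lambda>_. 1 / 4) MV_translation
          (\<lambda>n. \<Sum>j = 1..J. of_real (\<rho> j) * conj_local (j * \<kappa>) u n) n)
        \<longlonglongrightarrow> laurent (signs \<times> signs) (\<lambda>_. 1 / 4) MV_translation v n"
      unfolding laurent_def translate_def by (intro tendsto_sum tendsto_mult tendsto_const action[OF v u])
    moreover have "laurent K c s (\<lambda>n. \<Sum>j = 1..J. of_real (\<rho> j) * conj_local (j * \<kappa>) u n) n
        = (\<Sum>j = 1..J. of_real (\<rho> j) * laurent K c s (conj_local (j * \<kappa>) u) n)"
      for K :: "(int \<times> int) set" and c s J
      unfolding laurent_def translate_def sum_distrib_left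
      by (subst sum.swap) (simp add: mult_ac)
    ultimately have MVv: "(\<lambda>J. \<Sum>j = 1..J. of_real (\<rho> j) * MV (conj_local (j * \<kappa>) u) n) \<longlonglongrightarrow> MV v n"
      unfolding MV_eq_laurent by simp
    have "(\<lambda>J. \<i> * ((\<Sum>j = 1..J. of_real (\<rho> j) * MV (conj_local (j * \<kappa>) u) n)
        - (\<Sum>j = 1..J. of_real (\<rho> j) * conj_local (j * \<kappa>) (MV u) n))) \<longlonglongrightarrow> B u n"
      unfolding Bu by (intro tendsto_mult tendsto_const tendsto_diff MVv action[OF w MVu])
    moreover have "\<i> * ((\<Sum>j = 1..J. of_real (\<rho> j) * MV (conj_local (j * \<kappa>) u) n)
        - (\<Sum>j = 1..J. of_real (\<rho> j) * conj_local (j * \<kappa>) (MV u) n))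
      = (\<Sum>j = 1..J. of_real (\<rho> j) * comm_local (j * \<kappa>) u n)" for J
      unfolding commutator_conj_local[symmetric] sum_subtractf[symmetric] sum_distrib_left
      by (intro sum.cong refl) (simp add: algebra_simps)
    ultimately show ?thesis by simp
  qed
  show ?thesis
  proof
    show "summable (\<lambda>j. \<bar>\<rho> (Suc j)\<bar>)" by (rule coefficients_summable[OF \<open>\<kappa> \<ge> 1\<close> dom])
    show "(\<lambda>j. of_real (\<rho> (Suc j)) * comm_local (Suc j * \<kappa>) u n) sums B u n"
      if "u \<in> compactly_supported" for u n
      using series[OF that, of n] unfolding sums_def by (simp only: One_nat_def sum.atLeast1_atMost_eq)
  qed
qed

lemma wave_norm_le: "l2_norm (wave a b L) \<le> 1"
proof (cases "L = 0")
  case True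
  then have "wave a b L = (\<lambda>n. 0)" by (auto simp: wave_def)
  then show ?thesis by (simp add: l2_norm_def)
qed (simp add: wave_norm)

lemma wave_laurent_bound:
  "cmod (l2_inner (wave a b L) (laurent K c s (wave a b L))) \<le> (\<Sum>k\<in>K. cmod (c k))"
proof -
  have le1: "cmod (l2_inner (wave a b L) (translate t (wave a b L))) \<le> 1" for t
  proof -
    have "cmod (l2_inner (wave a b L) (translate t (wave a b L))) \<le> l2_norm (wave a b L) * l2_norm (wave a b L)"
      using l2_cauchy_schwarz[OF wave_ell2 translate_ell2[OF wave_ell2]] by (simp add: l2_norm_translate)
    also have "\<dots> \<le> 1" using wave_norm_le[of a b L] by (simp add: mult_le_one)
    finally show ?thesis .
  qed
  show ?thesis
    unfolding l2_inner_laurent[OF wave_ell2]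
    by (rule sum_norm_le) (use le1 in \<open>simp add: norm_mult mult_left_le\<close>)
qed

text \<open>
  Each term of the series converges as the box grows, and it is dominated by a multiple of
  \<open>\<bar>\<rho>\<^sub>j\<bar>\<close> uniformly in \<open>L\<close>; Tannery's theorem exchanges the two limits.
\<close>

lemma commutator_form_tendsto:
  fixes \<rho> :: "nat \<Rightarrow> real"
  assumes "\<kappa> \<ge> 1" and \<rho>: "summable (\<lambda>j. \<bar>\<rho> j\<bar>)"
    and B: "\<And>u n. u \<in> compactly_supported \<Longrightarrow>
      (\<lambda>j. of_real (\<rho> j) * comm_local (Suc j * \<kappa>) u n) sums B u n"
  shows "summable (\<lambda>j. \<rho> j * g_fun (Suc j * \<kappa>) (vec2 (cos a) (cos b)))"
    and "(\<lambda>L. l2_inner (wave a b L) (B (wave a b L)))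
      \<longlonglongrightarrow> of_real (\<Sum>j. \<rho> j * g_fun (Suc j * \<kappa>) (vec2 (cos a) (cos b)))"
proof -
  define g where "g j = g_fun (Suc j * \<kappa>) (vec2 (cos a) (cos b))" for j
  let ?u = "wave a b"
  have lim: "(\<lambda>L. of_real (\<rho> j) * l2_inner (?u L) (comm_local (Suc j * \<kappa>) (?u L))) \<longlonglongrightarrow> of_real (\<rho> j * g j)" for j
  proof -
    have "Suc j * \<kappa> \<ge> 1" using \<open>\<kappa> \<ge> 1\<close> by simp
    from g_fun_cos[OF this] have "complex_of_real (g j) = symbol a b comm_indices comm_coeff (comm_translation (Suc j * \<kappa>))"
      unfolding comm_symbol g_def by simp
    then show ?thesis
      unfolding of_real_mult comm_local_def by (simp only:) (intro tendsto_mult tendsto_const wave_laurent_tendsto)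
  qed
  define C where "C = (\<Sum>k\<in>comm_indices. cmod (comm_coeff k))"
  have bound: "norm (of_real (\<rho> j) * l2_inner (?u L) (comm_local (Suc j * \<kappa>) (?u L))) \<le> \<bar>\<rho> j\<bar> * C" for j L
    unfolding norm_mult norm_of_real comm_local_def C_def by (intro mult_left_mono wave_laurent_bound) auto
  have form: "(\<lambda>j. of_real (\<rho> j) * l2_inner (?u L) (comm_local (Suc j * \<kappa>) (?u L))) sums l2_inner (?u L) (B (?u L))" for L
  proof -
    define F where "F = {n. ?u L n \<noteq> 0}"
    have F: "finite F" using wave_compactly_supported[of a b L] by (simp add: compactly_supported_def F_def)
    have inner: "l2_inner (?u L) v = (\<Sum>n\<in>F. cnj (?u L n) * v n)" for v
      by (intro l2_inner_finite_support F) (auto simp: F_def)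
    have "(\<lambda>j. \<Sum>n\<in>F. cnj (?u L n) * (of_real (\<rho> j) * comm_local (Suc j * \<kappa>) (?u L) n))
        sums (\<Sum>n\<in>F. cnj (?u L n) * B (?u L) n)"
      by (intro sums_sum sums_mult B wave_compactly_supported)
    then show ?thesis unfolding inner by (simp add: sum_distrib_left mult_ac)
  qed
  have tannery: "summable (\<lambda>j. norm (complex_of_real (\<rho> j * g j))) \<and>
      (\<lambda>L. \<Sum>j. of_real (\<rho> j) * l2_inner (?u L) (comm_local (Suc j * \<kappa>) (?u L))) \<longlonglongrightarrow> (\<Sum>j. of_real (\<rho> j * g j))"
  proof -
    have "\<forall>\<^sub>F (j, L) in sequentially \<times>\<^sub>F sequentially.
        norm (of_real (\<rho> j) * l2_inner (?u L) (comm_local (Suc j * \<kappa>) (?u L))) \<le> \<bar>\<rho> j\<bar> * C"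
      by (intro always_eventually allI) (simp only: bound split_beta)
    from tannerys_theorem[OF lim this summable_mult2[OF \<rho>] sequentially_bot, THEN conjunct2]
    show ?thesis .
  qed
  then have "summable (\<lambda>j. \<bar>\<rho> j * g j\<bar>)" by (simp only: norm_of_real)
  then have summ: "summable (\<lambda>j. \<rho> j * g j)" by (rule summable_rabs_cancel)
  then show "summable (\<lambda>j. \<rho> j * g_fun (Suc j * \<kappa>) (vec2 (cos a) (cos b)))" unfolding g_def .
  have "(\<Sum>j. complex_of_real (\<rho> j * g j)) = of_real (\<Sum>j. \<rho> j * g j)"
    using summ by (rule suminf_of_real[symmetric])
  with tannery form[THEN sums_unique, symmetric]
  show "(\<lambda>L. l2_inner (wave a b L) (B (wave a b L)))
      \<longlonglongrightarrow> of_real (\<Sum>j. \<rho> j * g_fun (Suc j * \<kappa>) (vec2 (cos a) (cos b)))"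
    unfolding g_def by simp
qed

text \<open>
  Both the expectation of \<open>D\<close> and the norm of its image converge to what they are on an exact
  eigenvector: the squared norm tends to \<open>E\<^sup>2 - 2E\<cdot>E + E\<^sup>2 = 0\<close>.
\<close>

lemma wave_approximate_eigenvector:
  assumes "E = cos a * cos b"
  shows "(\<lambda>L. l2_norm (\<lambda>n. MV (wave a b L) n - of_real E * wave a b L n)) \<longlonglongrightarrow> 0"
proof -
  let ?u = "wave a b"
  define r where "r L = (\<lambda>n. MV (?u L) n - of_real E * ?u L n)" for L
  note sym = MV_symbol[of a b, folded assms]
  have inner: "(\<lambda>L. l2_inner (?u L) (MV (?u L))) \<longlonglongrightarrow> of_real E"
    using wave_laurent_tendsto[of a b "signs \<times> signs" "\<lambda>_. 1 / 4" MV_translation]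
    unfolding sym MV_eq_laurent .
  have normsq: "(\<lambda>L. (l2_norm (MV (?u L)))\<^sup>2) \<longlonglongrightarrow> E\<^sup>2"
    using wave_laurent_norm_tendsto[of "signs \<times> signs" "\<lambda>_. 1 / 4" MV_translation a b]
    unfolding sym MV_eq_laurent by simp
  have one: "(\<lambda>L. (l2_norm (?u L))\<^sup>2) \<longlonglongrightarrow> 1"
    by (intro tendsto_eventually eventually_mono[OF eventually_gt_at_top[of 0]]) (simp add: wave_norm)
  have expand: "(l2_norm (r L))\<^sup>2 = (l2_norm (MV (?u L)))\<^sup>2 - 2 * E * Re (l2_inner (?u L) (MV (?u L))) + E\<^sup>2 * (l2_norm (?u L))\<^sup>2" for L
  proof -
    have u: "?u L \<in> ell2" and Mu: "MV (?u L) \<in> ell2"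
      unfolding MV_eq_laurent by (intro wave_ell2 laurent_ell2)+
    have "r L \<in> ell2" unfolding r_def by (intro ell2_diff ell2_scale u Mu)
    then have "complex_of_real ((l2_norm (r L))\<^sup>2) = l2_inner (r L) (r L)" by (simp only: l2_inner_self)
    also have "\<dots> = l2_inner (MV (?u L)) (MV (?u L)) - of_real E * (l2_inner (?u L) (MV (?u L)) + cnj (l2_inner (?u L) (MV (?u L))))
        + of_real E * of_real E * l2_inner (?u L) (?u L)"
      unfolding r_def using u Mu
      by (simp add: l2_inner_diff_right l2_inner_diff_left ell2_diff ell2_scale l2_inner_scale_left
         l2_inner_scale_right l2_inner_cnj algebra_simps)
    also have "\<dots> = complex_of_real ((l2_norm (MV (?u L)))\<^sup>2 - 2 * E * Re (l2_inner (?u L) (MV (?u L))) + E\<^sup>2 * (l2_norm (?u L))\<^sup>2)"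
      unfolding complex_add_cnj l2_inner_self[OF u] l2_inner_self[OF Mu] by (simp add: power2_eq_square)
    finally show ?thesis by (simp only: of_real_eq_iff)
  qed
  have "(\<lambda>L. (l2_norm (r L))\<^sup>2) \<longlonglongrightarrow> E\<^sup>2 - 2 * E * Re (of_real E) + E\<^sup>2 * 1"
    unfolding expand by (intro tendsto_add tendsto_diff tendsto_mult tendsto_const normsq one tendsto_Re inner)
  then have "(\<lambda>L. sqrt ((l2_norm (r L))\<^sup>2)) \<longlonglongrightarrow> sqrt 0"
    by (intro tendsto_real_sqrt) (simp add: power2_eq_square)
  then show ?thesis by (simp add: r_def)
qed

text \<open>
  A bounded inverse of \<open>D - E\<close> would bound the norm of an approximate eigenvector by that of its image.
\<close>

lemma spectrum_MV:
  assumes E: "E = cos a * cos b"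
  shows "complex_of_real E \<in> spectrum (MV :: (int^2) oper)"
proof (rule ccontr)
  assume "complex_of_real E \<notin> spectrum (MV :: (int^2) oper)"
  then have "\<exists>R. bounded_oper R \<and> (\<forall>u\<in>ell2. R (\<lambda>n. (MV :: (int^2) oper) u n - of_real E * u n) = u \<and>
      (\<lambda>n. MV (R u) n - of_real E * R u n) = u)"
    by (simp only: spectrum_def mem_Collect_eq not_not)
  then obtain R where *: "bounded_oper R \<and> (\<forall>u\<in>ell2. R (\<lambda>n. (MV :: (int^2) oper) u n - of_real E * u n) = u \<and>
      (\<lambda>n. MV (R u) n - of_real E * R u n) = u)" ..
  then have R: "bounded_oper R" by (rule conjunct1)
  from * have inv: "u \<in> ell2 \<Longrightarrow> R (\<lambda>n. (MV :: (int^2) oper) u n - of_real E * u n) = u" for u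
    by simp
  obtain C where C: "\<And>u. u \<in> ell2 \<Longrightarrow> l2_norm (R u) \<le> C * l2_norm u"
    using R unfolding bounded_oper_def by blast
  let ?r = "\<lambda>L n. MV (wave a b L) n - of_real E * wave a b L n"
  have r: "?r L \<in> ell2" for L
    unfolding MV_eq_laurent by (intro ell2_diff ell2_scale wave_ell2 laurent_ell2)
  have "1 \<le> C * l2_norm (?r L)" if "L > 0" for L
    using C[OF r[of L]] inv[OF wave_ell2[of a b L]] wave_norm[OF that, of a b] by simp
  then have "\<forall>\<^sub>F L in sequentially. 1 \<le> C * l2_norm (?r L)"
    by (intro eventually_mono[OF eventually_gt_at_top[of 0]])
  moreover have "(\<lambda>L. C * l2_norm (?r L)) \<longlonglongrightarrow> C * 0"
    by (intro tendsto_mult tendsto_const wave_approximate_eigenvector E)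
  ultimately have "1 \<le> C * 0" by (intro tendsto_lowerbound[OF _ _ sequentially_bot])
  then show False by simp
qed

text \<open>
  Truncated waves have unit norm and are nearly fixed by the spectral projection, so testing the
  Mourre estimate on them leaves \<open>\<gamma>\<close> on one side and the limiting expectation \<open>G\<close> of the commutator on
  the other.
\<close>

lemma mourre_lower_bound:
  fixes B :: "(int^2) oper"
  assumes spec: "is_spectral_measure MV P" and B: "bounded_oper B"
    and I: "a' < E" "E < b'" and E: "E = cos a * cos b" and "\<gamma> > 0"
    and le: "oper_le (\<lambda>u n. of_real \<gamma> * P {a'<..<b'} u n) (P {a'<..<b'} \<circ> B \<circ> P {a'<..<b'})"
    and lim: "(\<lambda>L. l2_inner (wave a b L) (B (wave a b L))) \<longlonglongrightarrow> of_real G"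
  shows "\<gamma> \<le> G"
proof -
  interpret spectral_measure_of MV P
    by unfold_locales (use spec in \<open>simp_all add: MV_eq_laurent laurent_ell2 laurent_linear\<close>)
  let ?P = "P {a'<..<b'}"
  let ?u = "wave a b"
  have Pu: "?P (?u L) \<in> ell2" for L by (intro P_ell2 wave_ell2) simp
  define e where "e L = (\<lambda>n. ?u L n - ?P (?u L) n)" for L
  have e: "e L \<in> ell2" for L unfolding e_def by (intro ell2_diff wave_ell2 Pu)
  obtain C where C: "C \<ge> 0" "\<And>u. u \<in> ell2 \<Longrightarrow> l2_norm (B u) \<le> C * l2_norm u"
  proof -
    obtain C where "\<And>u. u \<in> ell2 \<Longrightarrow> l2_norm (B u) \<le> C * l2_norm u"
      using B unfolding bounded_oper_def by blast
    moreover have "C * l2_norm u \<le> \<bar>C\<bar> * l2_norm u" for u :: "int^2 \<Rightarrow> complex"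
      by (intro mult_right_mono) auto
    ultimately show ?thesis using that[of "\<bar>C\<bar>"] by (meson abs_ge_zero order_trans)
  qed
  have B_ell2: "u \<in> ell2 \<Longrightarrow> B u \<in> ell2" for u using B by (simp add: bounded_oper_def)
  define \<delta> where "\<delta> = min (E - a') (b' - E)"
  have \<delta>: "\<delta> > 0" "a' \<le> E - \<delta>" "E + \<delta> \<le> b'" using I by (auto simp: \<delta>_def)
  have e_lim: "(\<lambda>L. l2_norm (e L)) \<longlonglongrightarrow> 0"
  proof (rule Lim_null_comparison)
    show "\<forall>\<^sub>F L in sequentially. norm (l2_norm (e L))
        \<le> (2 / \<delta>) * l2_norm (\<lambda>n. MV (?u L) n - of_real E * ?u L n)"
      using spectral_localization[OF wave_ell2 \<delta>, of a b] \<delta>(1)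
      by (intro always_eventually allI) (simp add: e_def field_simps)
    show "(\<lambda>L. (2 / \<delta>) * l2_norm (\<lambda>n. MV (?u L) n - of_real E * ?u L n)) \<longlonglongrightarrow> 0"
      using tendsto_mult[OF tendsto_const wave_approximate_eigenvector[OF E], of "2 / \<delta>"] by simp
  qed
  have bound: "\<gamma> - (\<gamma> + C + C * (1 + l2_norm (e L))) * l2_norm (e L) \<le> Re (l2_inner (?u L) (B (?u L)))"
    if "L > 0" for L
  proof -
    let ?v = "?P (?u L)"
    note u = wave_ell2[of a b L] and v = Pu[of L] and eL = e[of L]
    note Bu = B_ell2[OF u] and Bv = B_ell2[OF v] and Be = B_ell2[OF eL]
    have v_eq: "?v = (\<lambda>n. ?u L n - e L n)" by (simp add: e_def)
    have Bv_eq: "B ?v = (\<lambda>n. B (?u L) n - B (e L) n)"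
    proof -
      have "B (\<lambda>n. 1 * ?u L n + (-1) * e L n) = (\<lambda>n. 1 * B (?u L) n + (-1) * B (e L) n)"
        using B u eL unfolding bounded_oper_def by blast
      then show ?thesis unfolding v_eq by simp
    qed
    have norm_u: "l2_norm (?u L) = 1" by (rule wave_norm[OF that])
    have norm_v: "l2_norm ?v \<le> 1 + l2_norm (e L)"
      using l2_norm_triangle[OF u ell2_scale[OF eL, of "-1"]] l2_norm_scale[of "-1" "e L"]
      unfolding v_eq norm_u by simp
    have "l2_inner (?u L) (\<lambda>n. (?P \<circ> B \<circ> ?P) (?u L) n - of_real \<gamma> * ?v n) \<in> \<real>\<^sub>\<ge>\<^sub>0"
      using le u unfolding oper_le_def by blast
    also have "l2_inner (?u L) (\<lambda>n. (?P \<circ> B \<circ> ?P) (?u L) n - of_real \<gamma> * ?v n)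
        = l2_inner (?u L) (?P (B ?v)) - of_real \<gamma> * l2_inner (?u L) ?v"
      using u v Bv by (simp add: l2_inner_diff_right P_ell2 ell2_scale l2_inner_scale_right)
    also have "l2_inner (?u L) (?P (B ?v)) = l2_inner ?v (B ?v)"
      using pvm_symmetric[OF pvm _ u Bv, of "{a'<..<b'}"] by simp
    \<comment> \<open>Replace the projected wave by the wave itself; the errors contain the small vector \<open>e L\<close>.\<close>
    also have "\<dots> = l2_inner (?u L) (B (?u L)) - l2_inner (?u L) (B (e L)) - l2_inner (e L) (B ?v)"
    proof -
      have "l2_inner ?v (B ?v) = l2_inner (?u L) (B ?v) - l2_inner (e L) (B ?v)"
        by (subst (1) v_eq) (rule l2_inner_diff_left[OF Bv u eL])
      also have "l2_inner (?u L) (B ?v) = l2_inner (?u L) (B (?u L)) - l2_inner (?u L) (B (e L))"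
        unfolding Bv_eq by (rule l2_inner_diff_right[OF u Bu Be])
      finally show ?thesis .
    qed
    also have "l2_inner (?u L) ?v = 1 - l2_inner (?u L) (e L)"
      unfolding v_eq l2_inner_diff_right[OF u u eL] l2_inner_self[OF u] norm_u by simp
    finally have "0 \<le> Re (l2_inner (?u L) (B (?u L)) - l2_inner (?u L) (B (e L)) - l2_inner (e L) (B ?v)
        - of_real \<gamma> * (1 - l2_inner (?u L) (e L)))"
      by (simp add: complex_nonneg_Reals_iff)
    then have "\<gamma> \<le> Re (l2_inner (?u L) (B (?u L))) - Re (l2_inner (?u L) (B (e L)))
        - Re (l2_inner (e L) (B ?v)) + \<gamma> * Re (l2_inner (?u L) (e L))"
      by (simp add: algebra_simps)
    moreover have "\<bar>Re (l2_inner (?u L) (B (e L)))\<bar> \<le> C * l2_norm (e L)"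
      using abs_Re_le_cmod[of "l2_inner (?u L) (B (e L))"] l2_cauchy_schwarz[OF u Be] C(2)[OF eL] norm_u
      by simp
    moreover have "\<bar>Re (l2_inner (e L) (B ?v))\<bar> \<le> C * (1 + l2_norm (e L)) * l2_norm (e L)"
    proof -
      have "l2_norm (B ?v) \<le> C * (1 + l2_norm (e L))"
        using C(2)[OF v] mult_left_mono[OF norm_v C(1)] by simp
      then have "l2_norm (e L) * l2_norm (B ?v) \<le> l2_norm (e L) * (C * (1 + l2_norm (e L)))"
        by (intro mult_left_mono) auto
      then show ?thesis
        using abs_Re_le_cmod[of "l2_inner (e L) (B ?v)"] l2_cauchy_schwarz[OF eL Bv]
        by (simp add: mult_ac)
    qed
    moreover have "\<gamma> * Re (l2_inner (?u L) (e L)) \<le> \<gamma> * l2_norm (e L)"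
      using abs_Re_le_cmod[of "l2_inner (?u L) (e L)"] l2_cauchy_schwarz[OF u eL] norm_u \<open>\<gamma> > 0\<close>
      by (intro mult_left_mono) auto
    ultimately show ?thesis by (simp add: algebra_simps)
  qed
  show ?thesis
  proof (rule LIMSEQ_le)
    have "(\<lambda>L. \<gamma> - (\<gamma> + C + C * (1 + l2_norm (e L))) * l2_norm (e L)) \<longlonglongrightarrow> \<gamma> - (\<gamma> + C + C * (1 + 0)) * 0"
      by (intro tendsto_intros e_lim)
    then show "(\<lambda>L. \<gamma> - (\<gamma> + C + C * (1 + l2_norm (e L))) * l2_norm (e L)) \<longlonglongrightarrow> \<gamma>" by simp
    show "(\<lambda>L. Re (l2_inner (?u L) (B (?u L)))) \<longlonglongrightarrow> G"
      using tendsto_Re[OF lim] by simp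
    show "\<exists>N. \<forall>L\<ge>N. \<gamma> - (\<gamma> + C + C * (1 + l2_norm (e L))) * l2_norm (e L) \<le> Re (l2_inner (?u L) (B (?u L)))"
      using bound by (intro exI[of _ 1]) auto
  qed
qed

lemma energy_surface_2_cos:
  assumes "x \<in> energy_surface E"
  obtains a b where "x = vec2 (cos a) (cos b)" "E = cos a * cos (b :: real)"
proof
  have "x $ 1 \<in> {-1..1}" "x $ 2 \<in> {-1..1}" using assms unfolding energy_surface_def by blast+
  then show "x = vec2 (cos (arccos (x $ 1))) (cos (arccos (x $ 2)))"
    by (simp add: vec2_eq_iff)
  then show "E = cos (arccos (x $ 1)) * cos (arccos (x $ 2))"
    using assms \<open>x $ 1 \<in> _\<close> \<open>x $ 2 \<in> _\<close> unfolding energy_surface_def UNIV_2 by simp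
qed

text \<open>
  The relation between the vectors \<open>(g\<^bsub>j\<kappa>\<^esub>(x\<^sub>q))\<^sub>j\<close> passes to every convergent combination \<open>G\<close>. If
  \<open>G\<close> were at least \<open>\<gamma> > 0\<close> at all the points, the relation would make \<open>G(x\<^sub>m)\<close> nonpositive.
\<close>

theorem Theta_level_subset_Theta:
  assumes "\<kappa> \<ge> 1"
  shows "Theta_level TYPE(2) m \<kappa> \<subseteq> Theta \<kappa> (MV :: (int^2) oper)"
proof
  fix E assume "E \<in> Theta_level TYPE(2) m \<kappa>"
  then obtain x :: "nat \<Rightarrow> real^2" and \<omega> :: "nat \<Rightarrow> real"
    where x: "\<And>q. q \<le> m \<Longrightarrow> x q \<in> energy_surface E" and \<omega>: "\<And>q. q < m \<Longrightarrow> \<omega> q \<le> 0"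
      and dep: "\<And>j. j \<ge> 1 \<Longrightarrow> g_fun (j * \<kappa>) (x m) = (\<Sum>q<m. \<omega> q * g_fun (j * \<kappa>) (x q))"
    unfolding Theta_level_def by blast
  have "complex_of_real E \<in> spectrum (MV :: (int^2) oper)"
    using x[of m] by (auto elim!: energy_surface_2_cos intro: spectrum_MV)
  moreover have "E \<notin> mourre_set \<kappa> (MV :: (int^2) oper)"
  proof
    assume "E \<in> mourre_set \<kappa> (MV :: (int^2) oper)"
    then obtain A and B :: "(int^2) oper" and P a' b' \<gamma> where A: "selfadjoint_lin_comb \<kappa> A"
      and B: "is_commutator MV A B" and P: "is_spectral_measure MV P" and I: "a' < E" "E < b'" and "\<gamma> > 0"
      and le: "oper_le (\<lambda>u n. of_real \<gamma> * P {a'<..<b'} u n) (P {a'<..<b'} \<circ> B \<circ> P {a'<..<b'})"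
      unfolding mourre_set_def by blast
    obtain \<rho> :: "nat \<Rightarrow> real" where \<rho>: "summable (\<lambda>j. \<bar>\<rho> j\<bar>)"
      "\<And>u n. u \<in> compactly_supported \<Longrightarrow>
        (\<lambda>j. of_real (\<rho> j) * comm_local (Suc j * \<kappa>) u n) sums B u n"
      using commutator_series[OF assms A B] by metis
    define G where "G y = (\<Sum>j. \<rho> j * g_fun (Suc j * \<kappa>) y)" for y :: "real^2"
    have B': "bounded_oper B" using B by (simp add: is_commutator_def)
    have G: "(\<lambda>j. \<rho> j * g_fun (Suc j * \<kappa>) (x q)) sums G (x q) \<and> \<gamma> \<le> G (x q)" if "q \<le> m" for q
      using x[OF that]
    proof (rule energy_surface_2_cos)
      fix a b assume xq: "x q = vec2 (cos a) (cos b)" and E: "E = cos a * cos b"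
      note form = commutator_form_tendsto[OF assms \<rho>, of a b, folded xq]
      show ?thesis
        using summable_sums[OF form(1)] mourre_lower_bound[OF P B' I E \<open>\<gamma> > 0\<close> le form(2)]
        by (simp add: G_def)
    qed
    have "(\<lambda>j. \<Sum>q<m. \<omega> q * (\<rho> j * g_fun (Suc j * \<kappa>) (x q))) sums (\<Sum>q<m. \<omega> q * G (x q))"
      using G by (intro sums_sum sums_mult) auto
    moreover have "(\<Sum>q<m. \<omega> q * (\<rho> j * g_fun (Suc j * \<kappa>) (x q))) = \<rho> j * g_fun (Suc j * \<kappa>) (x m)" for j
      using dep[of "Suc j"] by (simp only: sum_distrib_left mult_ac)
    ultimately have "G (x m) = (\<Sum>q<m. \<omega> q * G (x q))"
      using G[of m] sums_unique2 by auto
    also have "\<dots> \<le> 0"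
    proof (rule sum_nonpos)
      fix q assume "q \<in> {..<m}"
      then show "\<omega> q * G (x q) \<le> 0"
        using \<omega>[of q] G[of q] \<open>\<gamma> > 0\<close> by (intro mult_nonpos_nonneg) auto
    qed
    finally show False using G[of m] \<open>\<gamma> > 0\<close> by simp
  qed
  ultimately show "E \<in> Theta \<kappa> (MV :: (int^2) oper)" by (simp add: Theta_def)
qed

section \<open>A chain of angles in dimension two\<close>

text \<open>
  The map \<open>r \<mapsto> r'\<close> of the introduction. Only angles in \<open>[0, \<alpha>]\<close> matter; replacing larger ones by
  \<open>\<alpha>\<close> makes the iterates total and continuous in \<open>E\<close>, while for \<open>E > cos\<^sup>2 \<alpha>\<close>
  a clamped orbit stays above \<open>\<alpha>\<close>
  (\<open>orbit_stays_below\<close>), so that the clamping never disguises a chain as closed.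
\<close>

definition orbit_step :: "real \<Rightarrow> real \<Rightarrow> real \<Rightarrow> real" where
  "orbit_step \<alpha> E b = 2 * \<alpha> - arccos (E / cos (min b \<alpha>))"

definition orbit :: "real \<Rightarrow> real \<Rightarrow> nat \<Rightarrow> real" where
  "orbit \<alpha> E n = (orbit_step \<alpha> E ^^ n) 0"

lemma orbit_simps [simp]: "orbit \<alpha> E 0 = 0" "orbit \<alpha> E (Suc n) = orbit_step \<alpha> E (orbit \<alpha> E n)"
  by (simp_all add: orbit_def)

text \<open>
  The \<open>n\<close>-th energy of the sequence to be constructed. For even \<open>n\<close> the chain ends at \<open>\<alpha>\<close>, for odd \<open>n\<close>
  on the diagonal.
\<close>

definition closes_at :: "real \<Rightarrow> nat \<Rightarrow> real \<Rightarrow> bool" where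
  "closes_at \<alpha> n E \<longleftrightarrow> E \<in> {(cos \<alpha>)\<^sup>2<..cos \<alpha>} \<and>
     orbit \<alpha> E (Suc (n div 2)) = (if even n then \<alpha> else arccos (sqrt E))"

context
  fixes \<alpha> :: real
  assumes \<alpha>: "0 < \<alpha>" "\<alpha> \<le> pi / 4"
begin

lemma cos_half_band: "0 < cos \<alpha>" "cos \<alpha> < 1" "cos (2 * \<alpha>) < (cos \<alpha>)\<^sup>2" "(cos \<alpha>)\<^sup>2 < cos \<alpha>" "(cos \<alpha>)\<^sup>2 < 1"
proof -
  show c0: "0 < cos \<alpha>" using \<alpha> pi_gt_zero by (intro cos_gt_zero_pi) auto
  show c1: "cos \<alpha> < 1" using cos_monotone_0_pi[of 0 \<alpha>] \<alpha> pi_gt_zero by simp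
  show lt: "(cos \<alpha>)\<^sup>2 < cos \<alpha>" using mult_strict_left_mono[OF c1 c0] by (simp add: power2_eq_square)
  then show "(cos \<alpha>)\<^sup>2 < 1" using c1 by simp
  then show "cos (2 * \<alpha>) < (cos \<alpha>)\<^sup>2" by (simp add: cos_double_cos)
qed

lemma energy_bounds:
  assumes "E \<in> {(cos \<alpha>)\<^sup>2..cos \<alpha>}" shows "0 < E" "E < 1"
proof -
  have "0 < (cos \<alpha>)\<^sup>2" using cos_half_band(1) by simp
  moreover have "(cos \<alpha>)\<^sup>2 \<le> E" using assms by simp
  ultimately show "0 < E" by linarith
  show "E < 1" using assms cos_half_band(2) by auto
qed

lemma clamped_ratio:
  assumes "E \<in> {(cos \<alpha>)\<^sup>2..cos \<alpha>}" "0 \<le> b"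
  shows "cos \<alpha> \<le> cos (min b \<alpha>)" "(cos \<alpha>)\<^sup>2 \<le> E / cos (min b \<alpha>)" "E / cos (min b \<alpha>) \<le> 1"
proof -
  have "0 \<le> min b \<alpha>" "min b \<alpha> \<le> \<alpha>" using assms \<alpha> by auto
  then show c: "cos \<alpha> \<le> cos (min b \<alpha>)" using \<alpha> pi_gt_zero by (intro cos_monotone_0_pi_le) auto
  then have pos: "0 < cos (min b \<alpha>)" using cos_half_band(1) by linarith
  show "E / cos (min b \<alpha>) \<le> 1" using c pos assms by simp
  have "0 \<le> E" using energy_bounds(1)[OF assms(1)] by simp
  then have "E * 1 \<le> E * (1 / cos (min b \<alpha>))"
    using pos by (intro mult_left_mono) (auto simp: field_simps)
  then show "(cos \<alpha>)\<^sup>2 \<le> E / cos (min b \<alpha>)" using assms(1) by auto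
qed

lemma orbit_step_pos:
  assumes "E \<in> {(cos \<alpha>)\<^sup>2..cos \<alpha>}" "0 \<le> b" shows "0 < orbit_step \<alpha> E b"
proof -
  have "cos (2 * \<alpha>) < E / cos (min b \<alpha>)"
    using clamped_ratio[OF assms] cos_half_band(3) by linarith
  then have "arccos (E / cos (min b \<alpha>)) < arccos (cos (2 * \<alpha>))"
    using clamped_ratio[OF assms] by (intro arccos_less_arccos) auto
  also have "\<dots> = 2 * \<alpha>" using \<alpha> by (intro arccos_cos) auto
  finally show ?thesis by (simp add: orbit_step_def)
qed

lemma orbit_nonneg: "E \<in> {(cos \<alpha>)\<^sup>2..cos \<alpha>} \<Longrightarrow> 0 \<le> orbit \<alpha> E n"
  by (induction n) (simp_all add: less_imp_le orbit_step_pos)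

lemma orbit_step_mono:
  assumes E: "E \<in> {(cos \<alpha>)\<^sup>2..cos \<alpha>}" "E' \<in> {(cos \<alpha>)\<^sup>2..cos \<alpha>}" and "E \<le> E'" and b: "0 \<le> b" "b \<le> b'"
  shows "orbit_step \<alpha> E b \<le> orbit_step \<alpha> E' b'"
proof -
  have b': "0 \<le> b'" using b by simp
  have "cos (min b' \<alpha>) \<le> cos (min b \<alpha>)"
    using b \<alpha> pi_gt_zero by (intro cos_monotone_0_pi_le) auto
  moreover have "0 < cos (min b' \<alpha>)" using clamped_ratio(1)[OF E(2) b'] cos_half_band(1) by linarith
  moreover have "0 \<le> E" using energy_bounds(1)[OF E(1)] by simp
  ultimately have "E / cos (min b \<alpha>) \<le> E' / cos (min b' \<alpha>)"
    using \<open>E \<le> E'\<close> by (intro frac_le) auto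
  moreover have "0 \<le> (cos \<alpha>)\<^sup>2" by simp
  ultimately have "arccos (E' / cos (min b' \<alpha>)) \<le> arccos (E / cos (min b \<alpha>))"
    using clamped_ratio[OF E(1) b(1)] clamped_ratio[OF E(2) b'] by (intro arccos_le_arccos) linarith+
  then show ?thesis by (simp add: orbit_step_def)
qed

lemma orbit_mono:
  assumes "E \<in> {(cos \<alpha>)\<^sup>2..cos \<alpha>}" "E' \<in> {(cos \<alpha>)\<^sup>2..cos \<alpha>}" "E \<le> E'"
  shows "orbit \<alpha> E n \<le> orbit \<alpha> E' n"
  by (induction n) (auto intro!: orbit_step_mono orbit_nonneg assms)

lemma continuous_on_orbit: "continuous_on {(cos \<alpha>)\<^sup>2..cos \<alpha>} (\<lambda>E. orbit \<alpha> E n)"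
proof (induction n)
  case (Suc n)
  let ?S = "{(cos \<alpha>)\<^sup>2..cos \<alpha>}"
  have "cos (min (orbit \<alpha> E n) \<alpha>) \<noteq> 0" if "E \<in> ?S" for E
    using clamped_ratio(1)[OF that orbit_nonneg[OF that]] cos_half_band(1) by (metis not_less)
  moreover have "- 1 \<le> E / cos (min (orbit \<alpha> E n) \<alpha>) \<and> E / cos (min (orbit \<alpha> E n) \<alpha>) \<le> 1" if "E \<in> ?S" for E
    using clamped_ratio[OF that orbit_nonneg[OF that, of n]] zero_le_power2[of "cos \<alpha>"] by linarith
  ultimately show ?case
    unfolding orbit_simps orbit_step_def by (intro continuous_intros Suc.IH) auto
qed simp

text \<open>
  The product \<open>cos b cos(2\<alpha> - b)\<close> is largest at \<open>b = \<alpha>\<close>, where it is \<open>cos\<^sup>2 \<alpha>\<close>. So for \<open>E\<close> above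
  that value \<open>cos(2\<alpha> - b) < E / cos b\<close>, and the step moves every angle in \<open>[0, \<alpha>]\<close> up.
\<close>

lemma orbit_step_increases:
  assumes "E \<in> {(cos \<alpha>)\<^sup>2<..cos \<alpha>}" "0 \<le> b" "b \<le> \<alpha>"
  shows "b < orbit_step \<alpha> E b"
proof -
  have E: "E \<in> {(cos \<alpha>)\<^sup>2..cos \<alpha>}" using assms by auto
  have cb: "0 < cos b" using clamped_ratio(1)[OF E assms(2)] cos_half_band(1) assms by (simp add: min_absorb1)
  have "cos (2 * \<alpha> - b) * cos b \<le> (cos \<alpha>)\<^sup>2"
  proof -
    have "2 * (cos (2 * \<alpha> - b) * cos b) = cos (2 * \<alpha> - 2 * b) + cos (2 * \<alpha>)"
      by (simp add: cos_times_cos)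
    also have "\<dots> \<le> 1 + cos (2 * \<alpha>)" by simp
    also have "\<dots> = 2 * (cos \<alpha>)\<^sup>2" by (simp add: cos_double_cos)
    finally show ?thesis by simp
  qed
  also have "\<dots> < E" using assms by simp
  finally have "cos (2 * \<alpha> - b) < E / cos b" using cb by (simp add: field_simps)
  then have "arccos (E / cos b) < arccos (cos (2 * \<alpha> - b))"
    using clamped_ratio(3)[OF E assms(2)] assms(3) by (intro arccos_less_arccos) (auto simp: min_absorb1)
  also have "\<dots> = 2 * \<alpha> - b" using \<alpha> assms by (intro arccos_cos) auto
  finally show ?thesis using assms(3) by (simp add: orbit_step_def min_absorb1)
qed

text \<open>
  At \<open>E = cos\<^sup>2 \<alpha>\<close> the angle \<open>\<alpha>\<close> is fixed, and the strictly monotone step maps smaller angles to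
  smaller angles.
\<close>

lemma orbit_at_lower_edge: "orbit \<alpha> ((cos \<alpha>)\<^sup>2) n < \<alpha>"
proof (induction n)
  case (Suc n)
  let ?b = "orbit \<alpha> ((cos \<alpha>)\<^sup>2) n"
  have E: "(cos \<alpha>)\<^sup>2 \<in> {(cos \<alpha>)\<^sup>2..cos \<alpha>}" using cos_half_band(4) by simp
  have b: "0 \<le> ?b" by (rule orbit_nonneg[OF E])
  have "cos \<alpha> < cos ?b" using b Suc \<alpha> pi_gt_zero by (intro cos_monotone_0_pi) auto
  then have "(cos \<alpha>)\<^sup>2 / cos ?b < cos \<alpha>"
    using cos_half_band(1) by (simp add: field_simps power2_eq_square)
  moreover have "0 \<le> (cos \<alpha>)\<^sup>2 / cos ?b"
    using order_trans[OF zero_le_power2 clamped_ratio(2)[OF E b]] Suc by (simp add: min_absorb1)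
  ultimately have "arccos (cos \<alpha>) < arccos ((cos \<alpha>)\<^sup>2 / cos ?b)"
    using cos_half_band(2) by (intro arccos_less_arccos) auto
  then show ?case using Suc \<alpha> by (simp add: orbit_step_def min_absorb1 arccos_cos)
qed (use \<alpha> in simp)

lemma orbit_stays_below:
  assumes E: "E \<in> {(cos \<alpha>)\<^sup>2<..cos \<alpha>}" and n: "orbit \<alpha> E n \<le> \<alpha>" and "k \<le> n"
  shows "orbit \<alpha> E k \<le> \<alpha>"
proof (rule ccontr)
  assume k: "\<not> orbit \<alpha> E k \<le> \<alpha>"
  have "\<alpha> < orbit \<alpha> E i" if "i \<ge> k" for i
    using that
  proof (induction rule: dec_induct)
    case (step i)
    have "orbit_step \<alpha> E (orbit \<alpha> E i) = orbit_step \<alpha> E \<alpha>"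
      using step by (simp add: orbit_step_def min_absorb2)
    then show ?case using orbit_step_increases[OF E, of \<alpha>] \<alpha> by simp
  qed (use k in simp)
  then show False using n \<open>k \<le> n\<close> by fastforce
qed

lemma arccos_sqrt_less:
  assumes "E \<in> {(cos \<alpha>)\<^sup>2<..cos \<alpha>}" shows "arccos (sqrt E) < \<alpha>"
proof -
  have "cos \<alpha> < sqrt E" using assms by (intro real_less_rsqrt) auto
  moreover have "sqrt E \<le> 1" using assms cos_half_band(2) by auto
  ultimately have "arccos (sqrt E) < arccos (cos \<alpha>)"
    using cos_half_band(1) by (intro arccos_less_arccos) auto
  then show ?thesis using \<alpha> by (simp add: arccos_cos)
qed

text \<open>
  At the energy \<open>E\<close> the orbit point is \<open>\<alpha>\<close>, above \<open>arccos(sqrt E)\<close>; at the lower edge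
  \<open>arccos(sqrt E)\<close> equals \<open>\<alpha>\<close> and the orbit point is below it.
\<close>

lemma exists_odd_energy:
  assumes E: "E \<in> {(cos \<alpha>)\<^sup>2<..cos \<alpha>}" and "orbit \<alpha> E n = \<alpha>"
  shows "\<exists>E'. (cos \<alpha>)\<^sup>2 < E' \<and> E' < E \<and> orbit \<alpha> E' n = arccos (sqrt E')"
proof -
  let ?f = "\<lambda>E. orbit \<alpha> E n - arccos (sqrt E)"
  have "continuous_on {(cos \<alpha>)\<^sup>2..cos \<alpha>} ?f"
  proof (intro continuous_intros continuous_on_orbit ballI)
    fix x assume x: "x \<in> {(cos \<alpha>)\<^sup>2..cos \<alpha>}"
    show "-1 \<le> sqrt x \<and> sqrt x \<le> 1"
      using energy_bounds[OF x] by (auto intro: order_trans[of _ 0])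
  qed
  then have "continuous_on {(cos \<alpha>)\<^sup>2..E} ?f" by (rule continuous_on_subset) (use E in auto)
  moreover have lo: "?f ((cos \<alpha>)\<^sup>2) < 0"
    using orbit_at_lower_edge[of n] cos_half_band(1) \<alpha> by (simp add: arccos_cos)
  moreover have hi: "0 < ?f E" using arccos_sqrt_less[OF E] assms by simp
  ultimately obtain E' where "(cos \<alpha>)\<^sup>2 \<le> E'" "E' \<le> E" "?f E' = 0"
    using IVT'[of ?f "(cos \<alpha>)\<^sup>2" 0 E] E by auto
  then show ?thesis using lo hi by (intro exI[of _ E']) (auto simp: less_le)
qed

text \<open>
  If \<open>r\<^sub>n = arccos(sqrt E)\<close> then \<open>r\<^bsub>n+1\<^esub> = 2\<alpha> - r\<^sub>n > \<alpha>\<close>, whereas at the lower edge all orbit points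
  are below \<open>\<alpha>\<close>.
\<close>

lemma exists_even_energy:
  assumes E: "E \<in> {(cos \<alpha>)\<^sup>2<..cos \<alpha>}" and "orbit \<alpha> E n = arccos (sqrt E)"
  shows "\<exists>E'. (cos \<alpha>)\<^sup>2 < E' \<and> E' < E \<and> orbit \<alpha> E' (Suc n) = \<alpha>"
proof -
  have E01: "0 < E" "E \<le> 1" using energy_bounds[of E] E by auto
  have "sqrt E \<le> 1" using E01 by simp
  then have "cos (arccos (sqrt E)) = sqrt E" using E01 by (intro cos_arccos) (auto intro: order_trans[of _ 0])
  then have hi: "\<alpha> < orbit \<alpha> E (Suc n)"
    using assms(2) arccos_sqrt_less[OF E] E01 by (simp add: orbit_step_def min_absorb1 real_div_sqrt)
  moreover have lo: "orbit \<alpha> ((cos \<alpha>)\<^sup>2) (Suc n) < \<alpha>" by (rule orbit_at_lower_edge)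
  moreover have "continuous_on {(cos \<alpha>)\<^sup>2..E} (\<lambda>E. orbit \<alpha> E (Suc n))"
    by (rule continuous_on_subset[OF continuous_on_orbit]) (use E in auto)
  ultimately obtain E' where "(cos \<alpha>)\<^sup>2 \<le> E'" "E' \<le> E" "orbit \<alpha> E' (Suc n) = \<alpha>"
    using IVT'[of "\<lambda>E. orbit \<alpha> E (Suc n)" "(cos \<alpha>)\<^sup>2" \<alpha> E] E by auto
  then show ?thesis using lo hi by (intro exI[of _ E']) (auto simp: less_le simp del: orbit_simps)
qed

text \<open>
  An orbit that stays below \<open>\<alpha>\<close> increases, and its limit would be a fixed point of the step.
\<close>

lemma orbit_escapes:
  assumes E: "E \<in> {(cos \<alpha>)\<^sup>2<..cos \<alpha>}"
  shows "\<exists>n. \<alpha> < orbit \<alpha> E n"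
proof (rule ccontr)
  assume "\<not> (\<exists>n. \<alpha> < orbit \<alpha> E n)"
  then have le: "orbit \<alpha> E n \<le> \<alpha>" for n by (simp add: not_less)
  have E': "E \<in> {(cos \<alpha>)\<^sup>2..cos \<alpha>}" using E by auto
  have nonneg: "0 \<le> orbit \<alpha> E n" for n by (rule orbit_nonneg[OF E'])
  have "incseq (\<lambda>n. orbit \<alpha> E n)"
    using orbit_step_increases[OF E nonneg le] by (intro incseq_SucI) (simp add: less_imp_le)
  then obtain \<beta> where \<beta>: "(\<lambda>n. orbit \<alpha> E n) \<longlonglongrightarrow> \<beta>"
    using incseq_convergent[of "\<lambda>n. orbit \<alpha> E n" \<alpha>] le by blast
  have \<beta>_bounds: "0 \<le> \<beta>" "\<beta> \<le> \<alpha>"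
    using LIMSEQ_le_const[OF \<beta>, of 0] LIMSEQ_le_const2[OF \<beta>, of \<alpha>] nonneg le by auto
  have "continuous_on {0..} (orbit_step \<alpha> E)"
  proof -
    have "cos (min b \<alpha>) \<noteq> 0 \<and> - 1 \<le> E / cos (min b \<alpha>) \<and> E / cos (min b \<alpha>) \<le> 1" if "0 \<le> b" for b
      using clamped_ratio[OF E' that] cos_half_band(1) zero_le_power2[of "cos \<alpha>"] by linarith
    then show ?thesis unfolding orbit_step_def by (intro continuous_intros) auto
  qed
  then have "(\<lambda>n. orbit_step \<alpha> E (orbit \<alpha> E n)) \<longlonglongrightarrow> orbit_step \<alpha> E \<beta>"
    by (rule continuous_on_tendsto_compose[OF _ \<beta>]) (use nonneg \<beta>_bounds in auto)
  moreover have "(\<lambda>n. orbit_step \<alpha> E (orbit \<alpha> E n)) \<longlonglongrightarrow> \<beta>"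
    using LIMSEQ_Suc[OF \<beta>] by simp
  ultimately have "orbit_step \<alpha> E \<beta> = \<beta>" by (rule LIMSEQ_unique)
  then show False using orbit_step_increases[OF E \<beta>_bounds] by simp
qed

lemma closes_at_0: "closes_at \<alpha> 0 (cos \<alpha>)"
  using cos_half_band(4) \<alpha> by (simp add: closes_at_def orbit_step_def arccos_cos)

lemma closes_at_next:
  assumes "closes_at \<alpha> n E" shows "\<exists>E'. closes_at \<alpha> (Suc n) E' \<and> E' < E"
proof (cases "even n")
  case True
  then have "\<exists>E'. (cos \<alpha>)\<^sup>2 < E' \<and> E' < E \<and> orbit \<alpha> E' (Suc (n div 2)) = arccos (sqrt E')"
    using assms by (intro exists_odd_energy) (auto simp: closes_at_def)
  then show ?thesis using assms True by (fastforce simp: closes_at_def simp del: orbit_simps)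
next
  case False
  then have "\<exists>E'. (cos \<alpha>)\<^sup>2 < E' \<and> E' < E \<and> orbit \<alpha> E' (Suc (Suc (n div 2))) = \<alpha>"
    using assms by (intro exists_even_energy) (auto simp: closes_at_def)
  moreover have "Suc n div 2 = Suc (n div 2)" using False by (elim oddE) simp
  ultimately show ?thesis using assms False by (fastforce simp: closes_at_def simp del: orbit_simps)
qed

lemma exists_closing_energies:
  "\<exists>\<E>. \<E> 0 = cos \<alpha> \<and> (\<forall>n. closes_at \<alpha> n (\<E> n)) \<and> (\<forall>n. \<E> (Suc n) < \<E> n)"
proof -
  define next_energy where "next_energy n E = (SOME E'. closes_at \<alpha> (Suc n) E' \<and> E' < E)" for n E
  define \<E> where "\<E> = rec_nat (cos \<alpha>) next_energy"
  have next_energy: "closes_at \<alpha> (Suc n) (next_energy n E) \<and> next_energy n E < E" if "closes_at \<alpha> n E" for n E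
    unfolding next_energy_def using closes_at_next[OF that] by (rule someI_ex)
  have "closes_at \<alpha> n (\<E> n)" for n
    by (induction n) (auto simp: \<E>_def closes_at_0 next_energy)
  then show ?thesis
    using next_energy by (intro exI[of _ \<E>]) (auto simp: \<E>_def)
qed

text \<open>
  If the limit \<open>L\<close> were larger, the orbit for \<open>L\<close> would escape. By monotonicity in the energy it is
  dominated by the orbits for the even energies, and these are exactly \<open>\<alpha>\<close> at arbitrarily late times.
\<close>

lemma closing_energies_tendsto:
  assumes closes: "\<And>n. closes_at \<alpha> n (\<E> n)" and dec: "\<And>n. \<E> (Suc n) < \<E> n"
  shows "\<E> \<longlonglongrightarrow> (cos \<alpha>)\<^sup>2"
proof -
  have bounds: "(cos \<alpha>)\<^sup>2 < \<E> n" "\<E> n \<le> cos \<alpha>" for n using closes[of n] by (auto simp: closes_at_def)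
  have "decseq \<E>" using dec by (intro decseq_SucI) (simp add: less_imp_le)
  then obtain L where L: "\<E> \<longlonglongrightarrow> L" "\<And>n. L \<le> \<E> n"
    using decseq_convergent[of \<E> "(cos \<alpha>)\<^sup>2"] bounds by (metis less_imp_le)
  have "(cos \<alpha>)\<^sup>2 \<le> L" using LIMSEQ_le_const[OF L(1)] bounds by (meson less_imp_le)
  moreover have "\<not> (cos \<alpha>)\<^sup>2 < L"
  proof
    assume "(cos \<alpha>)\<^sup>2 < L"
    then have L_in: "L \<in> {(cos \<alpha>)\<^sup>2<..cos \<alpha>}" using L(2)[of 0] bounds(2)[of 0] by auto
    then obtain n where n: "\<alpha> < orbit \<alpha> L n" using orbit_escapes by blast
    then obtain k where k: "n = Suc k" using \<alpha> by (cases n) auto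
    have "orbit \<alpha> L n \<le> orbit \<alpha> (\<E> (2 * k)) n"
      using L_in L(2)[of "2 * k"] bounds[of "2 * k"] by (intro orbit_mono) auto
    also have "\<dots> = \<alpha>" using closes[of "2 * k"] by (simp add: closes_at_def k del: orbit_simps)
    finally show False using n by simp
  qed
  ultimately show ?thesis using L(1) by simp
qed

end

definition chain_point :: "real \<Rightarrow> real \<Rightarrow> nat \<Rightarrow> real ^ 2" where
  "chain_point \<alpha> E k = vec2 (cos (2 * \<alpha> - orbit \<alpha> E (Suc k))) (cos (orbit \<alpha> E k))"

lemma vec2_cos_energy_surface: "vec2 (cos a) (cos b) \<in> energy_surface (cos a * cos b)"
  by (simp add: energy_surface_def forall_2 UNIV_2)

lemma chain_point_energy_surface:
  assumes \<alpha>: "0 < \<alpha>" "\<alpha> \<le> pi / 4" and E: "E \<in> {(cos \<alpha>)\<^sup>2..cos \<alpha>}" and le: "orbit \<alpha> E k \<le> \<alpha>"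
  shows "cos (2 * \<alpha> - orbit \<alpha> E (Suc k)) * cos (orbit \<alpha> E k) = E"
    and "chain_point \<alpha> E k \<in> energy_surface E"
proof -
  let ?b = "orbit \<alpha> E k"
  note ratio = clamped_ratio[OF \<alpha> E orbit_nonneg[OF \<alpha> E, of k]]
  have "- 1 \<le> E / cos (min ?b \<alpha>)"
    using ratio(2) zero_le_power2[of "cos \<alpha>"] by linarith
  then have "cos (2 * \<alpha> - orbit \<alpha> E (Suc k)) = E / cos ?b"
    using ratio(3) le by (simp add: orbit_step_def min_absorb1 cos_arccos)
  moreover have "cos ?b \<noteq> 0" using ratio(1) le cos_half_band(1)[OF \<alpha>] by (simp add: min_absorb1)
  ultimately show "cos (2 * \<alpha> - orbit \<alpha> E (Suc k)) * cos ?b = E" by (simp del: orbit_simps)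
  then show "chain_point \<alpha> E k \<in> energy_surface E"
    unfolding chain_point_def by (metis vec2_cos_energy_surface)
qed

text \<open>
  Since \<open>j\<kappa> 2\<alpha> = 2\<pi>j\<close>, the reflection \<open>s \<mapsto> 2\<alpha> - s\<close> reverses the sign of \<open>sin(j\<kappa>s)\<close> for all \<open>j\<close> at
  once. The prefactors do not depend on \<open>j\<close>.
\<close>

lemma g_fun_chain_point:
  assumes "\<kappa> \<ge> 1" "j \<ge> 1" and \<alpha>: "\<alpha> = pi / real \<kappa>"
  shows "g_fun (j * \<kappa>) (chain_point \<alpha> E k)
    = cos (2 * \<alpha> - orbit \<alpha> E (Suc k)) * sin (orbit \<alpha> E k) * sin (real (j * \<kappa>) * orbit \<alpha> E k)
    - cos (orbit \<alpha> E k) * sin (2 * \<alpha> - orbit \<alpha> E (Suc k)) * sin (real (j * \<kappa>) * orbit \<alpha> E (Suc k))"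
proof -
  have "real (j * \<kappa>) * (2 * \<alpha> - s) = of_int (int j) * (2 * pi) - real (j * \<kappa>) * s" for s
    using \<open>\<kappa> \<ge> 1\<close> by (simp add: \<alpha> field_simps)
  then have reflect: "sin (real (j * \<kappa>) * (2 * \<alpha> - s)) = - sin (real (j * \<kappa>) * s)" for s
    using sin_int_2pin[of "int j"] cos_int_2pin[of "int j"] by (simp add: sin_diff mult_ac del: of_int_of_nat_eq)
  have "j * \<kappa> \<ge> 1" using assms by simp
  then show ?thesis
    unfolding chain_point_def g_fun_cos[OF \<open>j * \<kappa> \<ge> 1\<close>] reflect
    by (simp add: mult.assoc del: orbit_simps of_nat_mult)
qed

text \<open>
  Solve the formula for \<open>g\<^bsub>j\<kappa>\<^esub>\<close> at the last point for \<open>sin(j\<kappa>r\<^bsub>n+1\<^esub>)\<close>: the weight \<open>- t / p\<close> falls on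
  that point and the multiple \<open>t q / p\<close> of \<open>sin(j\<kappa>r\<^sub>n)\<close> is left to the shorter chain. The factor
  \<open>t \<ge> 0\<close> is arbitrary to make the induction work.
\<close>

lemma chain_dependence:
  assumes \<kappa>: "\<kappa> \<ge> 1" and \<alpha>: "\<alpha> = pi / real \<kappa>" "0 < \<alpha>" "\<alpha> \<le> pi / 4"
    and E: "E \<in> {(cos \<alpha>)\<^sup>2<..cos \<alpha>}"
  shows "(\<And>k. k \<le> n \<Longrightarrow> orbit \<alpha> E k \<le> \<alpha>) \<Longrightarrow> 0 \<le> t \<Longrightarrow>
    \<exists>\<omega>. (\<forall>q<n. \<omega> q \<le> 0) \<and> (\<forall>j\<ge>1. t * sin (real (j * \<kappa>) * orbit \<alpha> E n)
      = (\<Sum>q<n. \<omega> q * g_fun (j * \<kappa>) (chain_point \<alpha> E q)))"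
proof (induction n arbitrary: t)
  case (Suc n)
  have E': "E \<in> {(cos \<alpha>)\<^sup>2..cos \<alpha>}" using E by auto
  define r s where "r = orbit \<alpha> E n" and "s = orbit \<alpha> E (Suc n)"
  have r: "0 \<le> r" "r \<le> \<alpha>" and s: "0 \<le> s" "s \<le> \<alpha>"
    using Suc.prems(1)[OF le_SucI[OF order_refl]] Suc.prems(1)[OF order_refl] orbit_nonneg[OF \<alpha>(2,3) E'] unfolding r_def s_def by blast+
  define p q where "p = cos r * sin (2 * \<alpha> - s)" and "q = cos (2 * \<alpha> - s) * sin r"
  have p: "p > 0" unfolding p_def using r s \<alpha>(2,3) pi_gt_zero
    by (intro mult_pos_pos cos_gt_zero_pi sin_gt_zero) auto
  have q: "q \<ge> 0" unfolding q_def using r s \<alpha>(2,3) pi_gt_zero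
    by (intro mult_nonneg_nonneg cos_ge_zero sin_ge_zero) auto
  have "\<exists>\<omega>. (\<forall>k<n. \<omega> k \<le> 0) \<and> (\<forall>j\<ge>1. t * q / p * sin (real (j * \<kappa>) * orbit \<alpha> E n)
      = (\<Sum>k<n. \<omega> k * g_fun (j * \<kappa>) (chain_point \<alpha> E k)))"
    using Suc.prems p q by (intro Suc.IH) auto
  then obtain \<omega> where \<omega>: "\<And>k. k < n \<Longrightarrow> \<omega> k \<le> 0"
    "\<And>j. j \<ge> 1 \<Longrightarrow> t * q / p * sin (real (j * \<kappa>) * r) = (\<Sum>k<n. \<omega> k * g_fun (j * \<kappa>) (chain_point \<alpha> E k))"
    unfolding r_def by blast
  show ?case
  proof (intro exI[of _ "fun_upd \<omega> n (- (t / p))"] conjI allI impI)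
    fix k assume "k < Suc n"
    then show "(fun_upd \<omega> n (- (t / p))) k \<le> 0" using \<omega>(1) p Suc.prems(2) by auto
  next
    fix j :: nat assume j: "j \<ge> 1"
    have g_eq: "g_fun (j * \<kappa>) (chain_point \<alpha> E n) = q * sin (real (j * \<kappa>) * r) - p * sin (real (j * \<kappa>) * s)"
      unfolding g_fun_chain_point[OF \<kappa> j \<alpha>(1)] p_def q_def r_def s_def ..
    have "- (t / p) * g_fun (j * \<kappa>) (chain_point \<alpha> E n) + t * q / p * sin (real (j * \<kappa>) * r) = t * sin (real (j * \<kappa>) * s)"
      unfolding g_eq using p by (simp add: field_simps)
    then show "t * sin (real (j * \<kappa>) * orbit \<alpha> E (Suc n))
        = (\<Sum>q<Suc n. (fun_upd \<omega> n (- (t / p))) q * g_fun (j * \<kappa>) (chain_point \<alpha> E q))"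
      using \<omega>(2)[OF j] unfolding s_def[symmetric] by simp
  qed
qed simp

lemma pi_over_bounds:
  assumes "\<kappa> \<ge> (4 :: nat)" shows "0 < pi / real \<kappa>" "pi / real \<kappa> \<le> pi / 4"
  using assms by (simp, intro divide_left_mono) auto

text \<open>
  The first \<open>m\<close> points come from the chain. The last is the next chain point for even \<open>n\<close> and the
  diagonal point for odd \<open>n\<close>; in both cases \<open>g\<^bsub>j\<kappa>\<^esub>\<close> there is a nonnegative multiple of
  \<open>sin(j\<kappa>r\<^sub>m)\<close>, and \<open>chain_dependence\<close> applies.
\<close>

lemma closing_energy_in_Theta_level:
  assumes \<kappa>: "\<kappa> \<ge> 4" and \<alpha>: "\<alpha> = pi / real \<kappa>" and closes: "closes_at \<alpha> n E"
  shows "E \<in> Theta_level TYPE(2) (Suc n div 2) \<kappa>"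
proof -
  have \<kappa>1: "\<kappa> \<ge> 1" using \<kappa> by simp
  have \<alpha>_bounds: "0 < \<alpha>" "\<alpha> \<le> pi / 4" unfolding \<alpha> using pi_over_bounds[OF \<kappa>] .
  have E: "E \<in> {(cos \<alpha>)\<^sup>2<..cos \<alpha>}"
    using closes by (simp add: closes_at_def)
  then have E': "E \<in> {(cos \<alpha>)\<^sup>2..cos \<alpha>}" by auto
  have E01: "0 < E" "E \<le> 1"
    using energy_bounds[OF \<alpha>_bounds E'] by auto
  define m where "m = Suc n div 2"
  have last: "orbit \<alpha> E (Suc (n div 2)) \<le> \<alpha>"
    using closes arccos_sqrt_less[OF \<alpha>_bounds E] by (auto simp: closes_at_def simp del: orbit_simps split: if_splits)
  have le: "orbit \<alpha> E k \<le> \<alpha>" if "k \<le> m" for k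
    by (rule orbit_stays_below[OF \<alpha>_bounds E last]) (use that in \<open>auto simp: m_def\<close>)
  define x where "x k = (if odd n \<and> k = m then vec2 (sqrt E) (sqrt E) else chain_point \<alpha> E k)" for k
  define t where "t = (if odd n then 2 * sin (orbit \<alpha> E m) * sqrt E
     else cos (2 * \<alpha> - orbit \<alpha> E (Suc m)) * sin (orbit \<alpha> E m))"
  have x_in: "x k \<in> energy_surface E" if "k \<le> m" for k
  proof (cases "odd n \<and> k = m")
    case True
    then show ?thesis using E01 
      by (auto simp: x_def energy_surface_def forall_2 UNIV_2 intro: order_trans[of _ 0])
  next
    case False
    then show ?thesis using chain_point_energy_surface(2)[OF \<alpha>_bounds E' le[OF that]] unfolding x_def by presburger
  qed
  have t: "0 \<le> t" and g_last: "g_fun (j * \<kappa>) (x m) = t * sin (real (j * \<kappa>) * orbit \<alpha> E m)" if "j \<ge> 1" for j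
  proof -
    have r: "0 \<le> orbit \<alpha> E m" "orbit \<alpha> E m \<le> \<alpha>" by (auto intro: orbit_nonneg[OF \<alpha>_bounds E'] le)
    then have sin_r: "0 \<le> sin (orbit \<alpha> E m)" using \<alpha>_bounds by (intro sin_ge_zero) auto
    show "0 \<le> t"
    proof (cases "odd n")
      case False
      have "0 < cos (orbit \<alpha> E m)" using r \<alpha>_bounds pi_gt_zero by (intro cos_gt_zero_pi) linarith+
      moreover have "0 < cos (2 * \<alpha> - orbit \<alpha> E (Suc m)) * cos (orbit \<alpha> E m)"
        by (simp only: chain_point_energy_surface(1)[OF \<alpha>_bounds E' r(2)] E01)
      ultimately have "0 < cos (2 * \<alpha> - orbit \<alpha> E (Suc m))"
        using zero_less_mult_pos2 by blast
      then show ?thesis using False sin_r by (simp add: t_def del: orbit_simps)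
    qed (use sin_r E01 in \<open>simp add: t_def\<close>)
    have jk: "j * \<kappa> \<ge> 1" using that \<kappa>1 by simp
    show "g_fun (j * \<kappa>) (x m) = t * sin (real (j * \<kappa>) * orbit \<alpha> E m)"
    proof (cases "odd n")
      case True
      then have "m = Suc (n div 2)" by (auto simp: m_def elim!: oddE)
      then have "orbit \<alpha> E m = arccos (sqrt E)"
        using closes True by (simp add: closes_at_def del: orbit_simps)
      then have cos_r: "cos (orbit \<alpha> E m) = sqrt E"
        using E01 by (simp add: cos_arccos order_trans[of _ 0])
      show ?thesis
        using True g_fun_cos[OF jk, of "orbit \<alpha> E m" "orbit \<alpha> E m"] unfolding cos_r by (simp add: x_def t_def)
    next
      case False
      then have "m = n div 2" by (auto simp: m_def elim!: evenE)
      then have "orbit \<alpha> E (Suc m) = \<alpha>"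
        using closes False by (simp add: closes_at_def del: orbit_simps)
      moreover have "sin (real (j * \<kappa>) * \<alpha>) = 0"
        using sin_npi[of j] \<kappa>1 by (simp add: \<alpha>)
      ultimately show ?thesis
        using False g_fun_chain_point[OF \<kappa>1 that \<alpha>, of E m] by (simp add: x_def t_def del: orbit_simps of_nat_mult)
    qed
  qed
  obtain \<omega> where \<omega>: "\<forall>q<m. \<omega> q \<le> 0" "\<forall>j\<ge>1. t * sin (real (j * \<kappa>) * orbit \<alpha> E m)
      = (\<Sum>q<m. \<omega> q * g_fun (j * \<kappa>) (chain_point \<alpha> E q))"
    using chain_dependence[OF \<kappa>1 \<alpha> \<alpha>_bounds E le t[of 1], of m] by auto
  have "g_fun (j * \<kappa>) (x m) = (\<Sum>q<m. \<omega> q * g_fun (j * \<kappa>) (x q))" if "j \<ge> 1" for j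
    unfolding g_last[OF that] using \<omega>(2) that by (simp add: x_def)
  then show ?thesis
    unfolding Theta_level_def m_def[symmetric] using E01 x_in \<omega>(1)
    by (intro CollectI conjI exI[of _ x] exI[of _ \<omega>]) auto
qed

theorem theorem1p6:
  fixes \<kappa> :: nat
  assumes "\<kappa> \<ge> 4" and "even \<kappa>"
  shows "\<exists>\<E> :: nat \<Rightarrow> real.
    (\<forall>m n. m < n \<longrightarrow> \<E> n < \<E> m) \<and>
    \<E> 0 = Sup (J2 \<kappa>) \<and> Sup (J2 \<kappa>) = cos (pi / real \<kappa>) \<and>
    (\<forall>n. \<E> n \<in> Theta \<kappa> (MV :: (int^2) oper)) \<and>
    (\<forall>n\<ge>1. \<E> n \<in> J2 \<kappa>) \<and>
    \<E> \<longlonglongrightarrow> Inf (J2 \<kappa>) \<and> Inf (J2 \<kappa>) = (cos (pi / real \<kappa>))\<^sup>2 \<and>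
    (\<forall>n\<ge>1. \<E> (2 * n - 1) \<in> Theta_level TYPE(2) n \<kappa> \<and> \<E> (2 * n) \<in> Theta_level TYPE(2) n \<kappa>)"
proof -
  define \<alpha> where "\<alpha> = pi / real \<kappa>"
  have \<alpha>: "0 < \<alpha>" "\<alpha> \<le> pi / 4" unfolding \<alpha>_def using pi_over_bounds[OF assms(1)] .
  have Sup: "Sup (J2 \<kappa>) = cos \<alpha>" and Inf: "Inf (J2 \<kappa>) = (cos \<alpha>)\<^sup>2"
    unfolding J2_def \<alpha>_def[symmetric] using cos_half_band(4)[OF \<alpha>] by simp_all
  obtain \<E> where \<E>: "\<E> 0 = cos \<alpha>" "\<And>n. closes_at \<alpha> n (\<E> n)" "\<And>n. \<E> (Suc n) < \<E> n"
    using exists_closing_energies[OF \<alpha>] by blast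
  have anti: "\<E> n < \<E> m" if "m < n" for m n
    using that \<E>(3) by (induction rule: less_Suc_induct) auto
  have level: "\<E> n \<in> Theta_level TYPE(2) (Suc n div 2) \<kappa>" for n
    by (rule closing_energy_in_Theta_level[OF assms(1) \<alpha>_def \<E>(2)])
  have "\<E> n \<in> Theta \<kappa> (MV :: (int^2) oper)" for n
    using Theta_level_subset_Theta[of \<kappa>] level[of n] assms(1) by auto
  moreover have "\<E> n \<in> J2 \<kappa>" if "n \<ge> 1" for n
    using \<E>(2)[of n] anti[of 0 n] that \<E>(1)
    by (simp add: J2_def \<alpha>_def[symmetric] closes_at_def)
  moreover have "\<E> (2 * n - 1) \<in> Theta_level TYPE(2) n \<kappa>" if "n \<ge> 1" for n
    using level[of "2 * n - 1"] that by simp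
  moreover have "\<E> (2 * n) \<in> Theta_level TYPE(2) n \<kappa>" for n
    using level[of "2 * n"] by simp
  ultimately show ?thesis
    using anti closing_energies_tendsto[OF \<alpha> \<E>(2,3)] \<E>(1)
    unfolding Sup Inf \<alpha>_def[symmetric] by (intro exI[of _ \<E>]) simp
qed

end
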